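(* Let $1<p<\infty$, $-1<\alpha<\infty$ and $0<\beta<1$. Let $f\in\Lambda^*_{\beta,A^p_\alpha}$ and put $$A_\beta=\frac{2^{1+\beta}}{\pi}\int_0^\infty |\cos(t)-\cos(2t)|\,t^{\beta-2}\,dt .$$ Then for every integer $n\ge 1$, $$E_n^{p,\alpha}(f)\le A_\beta\, n^{-\beta}\,\|f\|_{\Lambda^*,\beta,A^p_\alpha}.$$
   Context: $\mathbb{D}$ is the open unit disc. For $1<p<\infty$, $\alpha>-1$, the weighted Bergman space $A^p_\alpha$ is the space of analytic functions $f$ in $\mathbb{D}$ with $\|f\|_{p,\alpha}=\left(\int_{\mathbb{D}}|f|^p\,dA_\alpha\right)^{1/p}<\infty$, where $dA_\alpha=(\alpha+1)\pi^{-1}(1-|z|^2)^\alpha\,dA(z)$ and $dA$ is Lebesgue area measure. For $f\in A^p_\alpha$ we say $f\in\Lambda^*_{\beta,A^p_\alpha}$ if there is a constant $C$ with $\|f(e^{it}\cdot)+f(e^{-it}\cdot)-2f(\cdot)\|_{p,\alpha}\le C|t|^\beta$ for all real $t$; $\|f\|_{\Lambda^*,\beta,A^p_\alpha}$ denotes the infimum of such constants $C$. $E_n^{p,\alpha}(f)=\min\{\|f-P\|_{p,\alpha}: P \text{ a polynomial of degree at most } n\}$. *)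

theory Defs
  imports "HOL-Complex_Analysis.Complex_Analysis"
begin

definition disc_measure :: "real \<Rightarrow> complex measure" where
  "disc_measure \<alpha> = density (restrict_space lborel (ball 0 1))
     (\<lambda>z. ennreal ((\<alpha> + 1) / pi * (1 - (norm z)\<^sup>2) powr \<alpha>))"

(* Functions on the disc are total functions of type complex => complex; nothing below depends
   on their values outside the disc. *)

definition bergman_space :: "real \<Rightarrow> real \<Rightarrow> (complex \<Rightarrow> complex) set" where
  "bergman_space p \<alpha> = {f. f holomorphic_on ball 0 1 \<and>
     integrable (disc_measure \<alpha>) (\<lambda>z. norm (f z) powr p)}"

(* The Bochner integral is 0 for non-integrable functions, so this is the norm only for
   members of bergman_space p \<alpha>. *)
definition bergman_norm :: "real \<Rightarrow> real \<Rightarrow> (complex \<Rightarrow> complex) \<Rightarrow> real" where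
  "bergman_norm p \<alpha> f = (\<integral>z. norm (f z) powr p \<partial>disc_measure \<alpha>) powr (1 / p)"

definition rot_diff2 :: "(complex \<Rightarrow> complex) \<Rightarrow> real \<Rightarrow> complex \<Rightarrow> complex" where
  "rot_diff2 f t = (\<lambda>z. f (cis t * z) + f (cis (- t) * z) - 2 * f z)"

definition zygmund_bound :: "real \<Rightarrow> real \<Rightarrow> real \<Rightarrow> (complex \<Rightarrow> complex) \<Rightarrow> real \<Rightarrow> bool" where
  "zygmund_bound \<beta> p \<alpha> f C \<longleftrightarrow>
     (\<forall>t::real. bergman_norm p \<alpha> (rot_diff2 f t) \<le> C * \<bar>t\<bar> powr \<beta>)"

definition zygmund_space :: "real \<Rightarrow> real \<Rightarrow> real \<Rightarrow> (complex \<Rightarrow> complex) set" where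
  "zygmund_space \<beta> p \<alpha> = {f \<in> bergman_space p \<alpha>. \<exists>C. zygmund_bound \<beta> p \<alpha> f C}"

definition zygmund_norm :: "real \<Rightarrow> real \<Rightarrow> real \<Rightarrow> (complex \<Rightarrow> complex) \<Rightarrow> real" where
  "zygmund_norm \<beta> p \<alpha> f = Inf {C. zygmund_bound \<beta> p \<alpha> f C}"

(* A minimum, not just an infimum: LEAST is unspecified unless a best approximant exists.  For
   f in bergman_space p \<alpha> it does, the polynomials of degree at most n being a
   finite-dimensional subspace. *)
definition best_approx :: "nat \<Rightarrow> real \<Rightarrow> real \<Rightarrow> (complex \<Rightarrow> complex) \<Rightarrow> real" where
  "best_approx n p \<alpha> f =
     (LEAST e. \<exists>P :: complex poly. degree P \<le> n \<and> e = bergman_norm p \<alpha> (\<lambda>z. f z - poly P z))"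

definition jackson_const :: "real \<Rightarrow> real" where
  "jackson_const \<beta> = 2 powr (1 + \<beta>) / pi *
     (LBINT t:{0<..}. \<bar>cos t - cos (2 * t)\<bar> * t powr (\<beta> - 2))"

end

theory Submission
  imports Defs "HOL-Probability.Sinc_Integral" "HOL-Real_Asymp.Real_Asymp"
begin

text \<open>
  The kernel \<open>(cos t - cos (2 * t)) / t\<^sup>2\<close> has as Fourier transform a trapezoid that is constant
  near the origin and vanishes beyond \<open>2\<close>. Averaging the rotations \<open>f (cis (2 * t / n) * z)\<close> against
  it multiplies the \<open>k\<close>-th Taylor coefficient of \<open>f\<close> by the trapezoid at \<open>2 * k / n\<close>, which gives
  a polynomial of degree less than \<open>n\<close>. Since the kernel is even, the error of this polynomial is an
  integral over \<open>t > 0\<close> of the kernel against the second differences of \<open>f\<close>, and Minkowski's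
  inequality for integrals bounds its norm by the Zygmund condition. This gives the constant
  \<open>2 powr \<beta> / pi\<close> times the integral, half of the one claimed.
\<close>

text \<open>The integral of the kernel over t > 0 is \<open>pi / 2\<close>, so the averages carry
  the factor \<open>2 / pi\<close>; pairing the rotations by s and -s costs another 1/2, whence the
  \<open>1 / pi\<close> in front of the second differences. The scale s = 2t/n contributes
  \<open>(2 / n) powr \<beta>\<close>. Since the kernel decays only like 1/t^2, its integral against
  \<open>t powr \<beta>\<close> converges at infinity because \<beta> < 1. The identity for the
  error is obtained at each fixed z by integrating the absolutely convergent Taylor series term by
  term; norms enter only afterwards. Two obstacles lie outside this argument.
  \<open>best_approx\<close> is a \<open>LEAST\<close>, which can be compared with a given
  polynomial only once the minimum is known to be attained; here rotation invariance makes monomials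
  orthogonal, which bounds the coefficients of a minimising sequence. And for \<alpha> < 0 the
  weight blows up at the circle, so that the finiteness of the disc measure, on which the
  integrability of polynomials rests, needs \<alpha> > -1.\<close>

no_notation fps_nth (infixl "$" 75)

section \<open>Rotation invariance and finiteness of the disc measure\<close>

text \<open>Boxes in the plane pull back to boxes of the same area in \<open>real^2\<close>. This
  carries results on orthogonal maps of \<open>real^'n\<close> over to complex rotations.\<close>

lemma lborel_complex_eq_distr:
  "(lborel :: complex measure) = distr lborel borel (\<lambda>v::real^2. Complex (v $ 1) (v $ 2))" (is "_ = ?M")
proof (rule lborel_eqI)
  have T [measurable]: "(\<lambda>v::real^2. Complex (v $ 1) (v $ 2)) \<in> borel_measurable borel"
    by (intro borel_measurable_continuous_onI continuous_intros)
  show "sets ?M = sets borel" by simp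
  fix l u :: complex
  assume le: "\<And>b. b \<in> Basis \<Longrightarrow> l \<bullet> b \<le> u \<bullet> b"
  let ?l = "vector [Re l, Im l] :: real^2" and ?u = "vector [Re u, Im u] :: real^2"
  have "(\<lambda>v::real^2. Complex (v $ 1) (v $ 2)) -` box l u = box ?l ?u"
    by (auto simp: in_box_complex_iff mem_box_cart forall_2)
  moreover have le': "?l $ i \<le> ?u $ i" for i
    using le[of 1] le[of \<i>] exhaust_2[of i] by (auto simp: Basis_complex_def)
  ultimately have "emeasure ?M (box l u) = emeasure lborel (box ?l ?u)"
    by (simp add: emeasure_distr)
  also have "\<dots> = (\<Prod>b\<in>Basis. (?u - ?l) \<bullet> b)"
    using le' by (subst emeasure_lborel_box)
      (auto simp: Basis_complex_def Basis_vec_def inner_axis forall_2)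
  also have "(\<Prod>b\<in>Basis. (?u - ?l) \<bullet> b) = (\<Prod>b\<in>Basis. (u - l) \<bullet> b)"
    by (simp add: Basis_complex_def Basis_vec_def inner_axis UNIV_2 axis_eq_axis mult.commute)
  finally show "emeasure ?M (box l u) = (\<Prod>b\<in>Basis. (u - l) \<bullet> b)" .
qed

text \<open>\<open>lborel\<close> is determined by its values on boxes, and the preimage of a box is
  its image under the orthogonal map \<open>inv R\<close>. The detour through
  \<open>lebesgue\<close> is made because \<open>measure_orthogonal_image\<close> speaks of that
  measure.\<close>

lemma distr_lborel_orthogonal_transformation:
  fixes R :: "real^'n::{finite,wellorder} \<Rightarrow> real^'n::_"
  assumes "orthogonal_transformation R"
  shows "distr lborel borel R = lborel"
proof (rule lborel_eqI[symmetric])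
  have lin: "linear R" and "bij R"
    using assms by (auto simp: orthogonal_transformation_linear orthogonal_transformation_bij)
  have inv: "orthogonal_transformation (inv R)"
    using assms by (rule orthogonal_transformation_inv)
  have R [measurable]: "R \<in> borel_measurable borel"
    using lin by (intro borel_measurable_continuous_onI) (simp add: linear_continuous_on linear_conv_bounded_linear)
  show "sets (distr lborel borel R) = sets borel" by simp
  fix l u :: "real^'n::_"
  assume le: "\<And>b. b \<in> Basis \<Longrightarrow> l \<bullet> b \<le> u \<bullet> b"
  have eq: "R -` box l u = inv R ` box l u"
    using \<open>bij R\<close> by (simp add: bij_vimage_eq_inv_image)
  have "R -` box l u \<in> sets borel"
    using measurable_sets[OF R, of "box l u"] by simp
  have m: "R -` box l u \<in> lmeasurable"
    unfolding eq by (rule measurable_orthogonal_image[OF inv]) simp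
  have "emeasure (distr lborel borel R) (box l u) = emeasure lborel (R -` box l u)"
    by (simp add: emeasure_distr)
  also have "\<dots> = emeasure lebesgue (R -` box l u)"
    using \<open>R -` box l u \<in> sets borel\<close> by simp
  also have "\<dots> = measure lebesgue (R -` box l u)"
    using m by (simp add: emeasure_eq_measure2)
  also have "measure lebesgue (R -` box l u) = measure lebesgue (box l u)"
    unfolding eq by (rule measure_orthogonal_image[OF inv]) simp
  also have "ennreal \<dots> = emeasure lborel (box l u)"
    by (simp add: emeasure_eq_measure2)
  also have "\<dots> = (\<Prod>b\<in>Basis. (u - l) \<bullet> b)"
    using le by (simp add: emeasure_lborel_box)
  finally show "emeasure (distr lborel borel R) (box l u) = (\<Prod>b\<in>Basis. (u - l) \<bullet> b)" .
qed

lemma distr_lborel_cis: "distr lborel borel (\<lambda>z. cis t * z) = lborel"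
proof -
  let ?T = "\<lambda>v::real^2. Complex (v $ 1) (v $ 2)"
  let ?R = "\<lambda>v::real^2. vector [cos t * v $ 1 - sin t * v $ 2, sin t * v $ 1 + cos t * v $ 2] :: real^2"
  have T [measurable]: "?T \<in> borel_measurable borel"
    by (intro borel_measurable_continuous_onI continuous_intros)
  have lin: "linear ?R"
    by (rule linearI) (simp_all add: vec_eq_iff forall_2 algebra_simps)
  have R [measurable]: "?R \<in> borel_measurable borel"
    using lin by (intro borel_measurable_continuous_onI) (simp add: linear_continuous_on linear_conv_bounded_linear)
  have "orthogonal_transformation ?R"
    unfolding orthogonal_transformation_def
  proof (intro conjI allI lin)
    fix v w :: "real^2"
    have "(cos t * v $ 1 - sin t * v $ 2) * (cos t * w $ 1 - sin t * w $ 2) +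
      (sin t * v $ 1 + cos t * v $ 2) * (sin t * w $ 1 + cos t * w $ 2) =
      (cos t ^ 2 + sin t ^ 2) * (v $ 1 * w $ 1 + v $ 2 * w $ 2)"
      by algebra
    then show "?R v \<bullet> ?R w = v \<bullet> w"
      by (simp add: inner_vec_def sum_2)
  qed
  then have "distr lborel borel ?R = lborel"
    by (rule distr_lborel_orthogonal_transformation)
  then have "lborel = distr (distr lborel borel ?R) borel ?T"
    by (simp add: lborel_complex_eq_distr[symmetric])
  also have "\<dots> = distr (distr lborel borel ?T) borel (\<lambda>z. cis t * z)"
    by (auto simp: distr_distr comp_def complex_eq_iff intro!: distr_cong)
  finally show ?thesis
    by (simp add: lborel_complex_eq_distr[symmetric])
qed

lemma space_disc_measure [simp]: "space (disc_measure \<alpha>) = ball 0 1"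
  by (simp add: disc_measure_def space_restrict_space)

lemma sets_disc_measure [measurable_cong]:
  "sets (disc_measure \<alpha>) = sets (restrict_space borel (ball 0 1))"
  unfolding disc_measure_def sets_density by (rule sets_restrict_space_cong) simp

lemma continuous_on_imp_measurable_disc_measure:
  "continuous_on (ball 0 1) g \<Longrightarrow> g \<in> borel_measurable (disc_measure \<alpha>)"
  using borel_measurable_continuous_on_restrict
  by (simp add: measurable_cong_sets[OF sets_disc_measure refl])

lemma nn_integral_disc_measure:
  assumes [measurable]: "g \<in> borel_measurable borel"
  shows "(\<integral>\<^sup>+z. g z \<partial>disc_measure \<alpha>) =
    (\<integral>\<^sup>+z. ennreal ((\<alpha> + 1) / pi * (1 - (norm z)\<^sup>2) powr \<alpha>) * g z * indicator (ball 0 1) z \<partial>lborel)"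
  unfolding disc_measure_def
  by (subst nn_integral_density)
    (auto simp: nn_integral_restrict_space intro!: measurable_restrict_space1)

lemma measurable_cis_disc_measure:
  "(\<lambda>z. cis t * z) \<in> measurable (disc_measure \<alpha>) (disc_measure \<alpha>)"
  unfolding measurable_cong_sets[OF sets_disc_measure sets_disc_measure]
  by (auto intro!: measurable_restrict_space3 simp: norm_mult)

text \<open>The density depends on z only through its norm and the disc is invariant, so weight and
  indicator of the disc can be rotated together with the set, and the invariance of
  \<open>lborel\<close> applies.\<close>

lemma distr_disc_measure_cis:
  "distr (disc_measure \<alpha>) (disc_measure \<alpha>) (\<lambda>z. cis t * z) = disc_measure \<alpha>"
proof (rule measure_eqI)
  note measurable_cis_disc_measure [measurable]
  fix A
  assume "A \<in> sets (distr (disc_measure \<alpha>) (disc_measure \<alpha>) (\<lambda>z. cis t * z))"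
  then have A: "A \<in> sets (disc_measure \<alpha>)"
    by simp
  then have Ab [measurable]: "A \<in> sets borel" and sub: "A \<subseteq> ball 0 1"
    by (auto simp: sets_disc_measure sets_restrict_space_iff)
  let ?g = "\<lambda>z. ennreal ((\<alpha> + 1) / pi * (1 - (norm z)\<^sup>2) powr \<alpha>) * indicator A z * indicator (ball 0 1) z"
  have g: "?g \<in> borel_measurable borel"
    by (intro borel_measurable_times_ennreal borel_measurable_indicator) auto
  have "emeasure (distr (disc_measure \<alpha>) (disc_measure \<alpha>) (\<lambda>z. cis t * z)) A =
    (\<integral>\<^sup>+z. indicator A z \<partial>distr (disc_measure \<alpha>) (disc_measure \<alpha>) (\<lambda>z. cis t * z))"
    using A by simp
  also have "\<dots> = (\<integral>\<^sup>+z. indicator A (cis t * z) \<partial>disc_measure \<alpha>)"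
    using A by (subst nn_integral_distr) auto
  also have "\<dots> = (\<integral>\<^sup>+z. ?g (cis t * z) \<partial>lborel)"
    by (subst nn_integral_disc_measure) (auto simp: norm_mult indicator_def)
  also have "\<dots> = (\<integral>\<^sup>+z. ?g z \<partial>distr lborel borel (\<lambda>z. cis t * z))"
    using g by (subst nn_integral_distr) simp_all
  also have "\<dots> = (\<integral>\<^sup>+z. indicator A z \<partial>disc_measure \<alpha>)"
    by (simp add: distr_lborel_cis nn_integral_disc_measure)
  also have "\<dots> = emeasure (disc_measure \<alpha>) A"
    using A by simp
  finally show "emeasure (distr (disc_measure \<alpha>) (disc_measure \<alpha>) (\<lambda>z. cis t * z)) A =
    emeasure (disc_measure \<alpha>) A" .
qed simp

lemma integrable_disc_measure_cis:
  fixes g :: "complex \<Rightarrow> 'a::{banach, second_countable_topology}"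
  assumes "integrable (disc_measure \<alpha>) g"
  shows "integrable (disc_measure \<alpha>) (\<lambda>z. g (cis t * z))"
  using integrable_distr[OF measurable_cis_disc_measure[of t \<alpha>], of g] assms
  by (simp add: distr_disc_measure_cis)

lemma integral_disc_measure_cis:
  fixes g :: "complex \<Rightarrow> 'a::{banach, second_countable_topology}"
  assumes "g \<in> borel_measurable (disc_measure \<alpha>)"
  shows "(\<integral>z. g (cis t * z) \<partial>disc_measure \<alpha>) = (\<integral>z. g z \<partial>disc_measure \<alpha>)"
  using integral_distr[OF measurable_cis_disc_measure[of t \<alpha>], of g] assms
  by (simp add: distr_disc_measure_cis)

section \<open>Area near the unit circle and finite total mass\<close>

lemma emeasure_annulus:
  fixes k :: nat
  shows "emeasure lborel {z::complex. norm z < 1 \<and> 1 - (norm z)\<^sup>2 \<le> (1/2) ^ k} = ennreal (pi * (1/2) ^ k)"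
proof -
  \<comment> \<open>Inner radius of the annulus. For k = 0 it is 0, the inner ball is empty and the
    annulus is the whole disc.\<close>
  define r where "r = sqrt (1 - (1/2) ^ k)"
  have le1: "(1/2::real) ^ k \<le> 1"
    by (simp add: power_le_one)
  then have r: "0 \<le> r" "r \<le> 1" "r\<^sup>2 = 1 - (1/2) ^ k"
    by (auto simp: r_def)
  have "(norm z < r) = ((norm z)\<^sup>2 < r\<^sup>2)" for z :: complex
    using r(1) by (metis norm_ge_zero power2_less_imp_less power_strict_mono pos2)
  then have "{z::complex. norm z < 1 \<and> 1 - (norm z)\<^sup>2 \<le> (1/2) ^ k} = ball 0 1 - ball 0 r"
    using r(3) by (auto simp: not_less)
  also have "emeasure lborel \<dots> = ennreal pi - ennreal (pi * r\<^sup>2)"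
    using r by (subst emeasure_Diff)
      (auto simp: emeasure_ball unit_ball_vol_2 subset_ball)
  also have "\<dots> = ennreal (pi * (1/2) ^ k)"
    using r(3) le1 by (subst ennreal_minus) (auto simp: right_diff_distrib)
  finally show ?thesis .
qed

lemma ex_dyadic_shell:
  fixes x :: real
  assumes "0 < x" "x \<le> 1"
  obtains k :: nat where "(1/2) ^ Suc k < x" "x \<le> (1/2) ^ k"
proof -
  obtain m where m: "(1/2) ^ m < x"
    using real_arch_pow_inv[OF \<open>0 < x\<close>, of "1/2"] by auto
  define l where "l = (LEAST m. (1/2) ^ m < x)"
  have l: "(1/2) ^ l < x"
    unfolding l_def using m by (rule LeastI)
  have "l \<noteq> 0"
    using l assms by (intro notI) auto
  then obtain k where k: "l = Suc k"
    by (cases l) auto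
  then have "\<not> (1/2) ^ k < x"
    using not_less_Least[of k "\<lambda>m. (1/2) ^ m < x"] by (simp add: l_def)
  then show ?thesis
    using that[of k] l k by auto
qed

text \<open>Where 1 - |z|^2 is about 2^(-k), the weight is about 2^(-\<alpha> k), while the area is
  at most pi 2^(-k). The total mass is thus dominated by a geometric series of ratio 2^(-(\<alpha> +
  1)), which is less than 1 because \<alpha> > -1.\<close>

lemma finite_measure_disc_measure:
  assumes "- 1 < \<alpha>"
  shows "finite_measure (disc_measure \<alpha>)"
proof (rule finite_measureI)
  \<comment> \<open>Within a dyadic shell 1 - |z|^2 varies by a factor of at most 2, hence its power
    by at most \<open>2 powr \<bar>\<alpha>\<bar>\<close>.\<close>
  define c where "c = (\<alpha> + 1) / pi * 2 powr \<bar>\<alpha>\<bar>"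
  define q where "q = 2 powr (- (\<alpha> + 1))"
  have c: "0 \<le> c" and q: "0 \<le> q" "q < 1"
    using assms by (auto simp: c_def q_def intro!: powr_less_one)
  let ?S = "\<lambda>k::nat. {z::complex. norm z < 1 \<and> 1 - (norm z)\<^sup>2 \<le> (1/2) ^ k}"
  let ?u = "\<lambda>k::nat. c * 2 powr (- \<alpha> * k)"
  have u: "0 \<le> ?u k" for k
    using c by simp
  have S [measurable]: "?S k \<in> sets borel" for k
    by measurable
  have "emeasure (disc_measure \<alpha>) (space (disc_measure \<alpha>)) = (\<integral>\<^sup>+z. 1 \<partial>disc_measure \<alpha>)"
    by simp
  also have "\<dots> = (\<integral>\<^sup>+z. ennreal ((\<alpha> + 1) / pi * (1 - (norm (z::complex))\<^sup>2) powr \<alpha>) * 1 * indicator (ball 0 1) z \<partial>lborel)"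
    by (subst nn_integral_disc_measure) simp_all
  \<comment> \<open>The annuli \<open>?S k\<close> are nested rather than disjoint. All terms are
    nonnegative, so the single term of the shell containing z already dominates the weight.\<close>
  also have "\<dots> \<le> (\<integral>\<^sup>+z. (\<Sum>k. ennreal (?u k) * indicator (?S k) z) \<partial>lborel)"
  proof (rule nn_integral_mono)
    fix z :: complex
    show "ennreal ((\<alpha> + 1) / pi * (1 - (norm z)\<^sup>2) powr \<alpha>) * 1 * indicator (ball 0 1) z \<le>
      (\<Sum>k. ennreal (?u k) * indicator (?S k) z)"
    proof (cases "norm z < 1")
      case True
      define h where "h = (\<lambda>k. ennreal (?u k) * indicator (?S k) z)"
      define x where "x = 1 - (norm z)\<^sup>2"
      have x: "0 < x" "x \<le> 1"
        using True by (auto simp: x_def power_less_one_iff)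
      obtain k where k: "(1/2) ^ Suc k < x" "x \<le> (1/2) ^ k"
        using x by (rule ex_dyadic_shell)
      have half: "(1/2::real) ^ j = 2 powr (- real j)" for j
        by (simp add: powr_minus powr_realpow field_simps)
      have "x powr \<alpha> \<le> 2 powr \<bar>\<alpha>\<bar> * 2 powr (- \<alpha> * k)"
      proof (cases "0 \<le> \<alpha>")
        case True
        then have "x powr \<alpha> \<le> ((1/2) ^ k) powr \<alpha>"
          using x k by (intro powr_mono2) auto
        also have "\<dots> = 2 powr (- \<alpha> * k)"
          unfolding half powr_powr by (simp add: mult.commute)
        also have "\<dots> = 1 * \<dots>"
          by simp
        also have "\<dots> \<le> 2 powr \<bar>\<alpha>\<bar> * 2 powr (- \<alpha> * k)"
          by (intro mult_right_mono ge_one_powr_ge_zero) auto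
        finally show ?thesis .
      next
        case False
        then have "x powr \<alpha> \<le> ((1/2) ^ Suc k) powr \<alpha>"
          using x k by (intro powr_mono2') auto
        also have "\<dots> = 2 powr \<bar>\<alpha>\<bar> * 2 powr (- \<alpha> * k)"
          unfolding half powr_powr using False by (simp add: powr_add[symmetric] algebra_simps)
        finally show ?thesis .
      qed
      then have "(\<alpha> + 1) / pi * x powr \<alpha> \<le> ?u k"
        using assms unfolding c_def mult.assoc by (intro mult_left_mono) auto
      then have "ennreal ((\<alpha> + 1) / pi * x powr \<alpha>) * 1 * indicator (ball 0 1) z \<le> h k"
        using True k by (simp add: ennreal_leI x_def h_def)
      also have "\<dots> = sum h {k}"
        by simp
      also have "\<dots> \<le> (\<Sum>k. h k)"
        by (rule sum_le_suminf) auto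
      finally show ?thesis
        by (simp add: x_def h_def)
    qed simp
  qed
  also have "\<dots> = (\<Sum>k. \<integral>\<^sup>+z. ennreal (?u k) * indicator (?S k) z \<partial>lborel)"
    by (rule nn_integral_suminf) measurable
  also have "\<dots> = (\<Sum>k. ennreal (c * pi * q ^ k))"
  proof (rule suminf_cong)
    fix k
    have "(\<integral>\<^sup>+z. ennreal (?u k) * indicator (?S k) z \<partial>lborel) = ennreal (?u k) * ennreal (pi * (1/2) ^ k)"
      by (subst nn_integral_cmult_indicator) (auto simp: emeasure_annulus)
    also have "\<dots> = ennreal (?u k * (pi * (1/2) ^ k))"
      using u by (simp add: ennreal_mult)
    also have "?u k * (pi * (1/2) ^ k) = c * pi * (2 powr (- \<alpha> * k) * 2 powr (- real k))"
      by (simp add: powr_minus powr_realpow field_simps)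
    also have "2 powr (- \<alpha> * k) * 2 powr (- real k) = q ^ k"
      unfolding q_def powr_add[symmetric]
      by (subst powr_realpow[symmetric]) (auto simp: powr_powr algebra_simps)
    finally show "(\<integral>\<^sup>+z. ennreal (?u k) * indicator (?S k) z \<partial>lborel) = ennreal (c * pi * q ^ k)" .
  qed
  also have "\<dots> < \<infinity>"
    using q c by (subst suminf_ennreal2) (auto intro!: summable_mult summable_geometric)
  finally show "emeasure (disc_measure \<alpha>) (space (disc_measure \<alpha>)) \<noteq> \<infinity>"
    by simp
qed

section \<open>The trapezoid kernel\<close>

text \<open>Integration by parts turns the integrand into \<open>sin (a * t) / t\<close>, which
  explains the antiderivative with \<open>Si\<close>; the value comes from the limit pi/2 of
  \<open>Si\<close> at infinity. As the integrand is nonnegative, the fundamental theorem yields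
  integrability together with the value.\<close>

lemma one_minus_cos_over_square_integral_pos:
  fixes a :: real
  assumes a: "0 < a"
  shows "set_integrable lborel {0<..} (\<lambda>t. (1 - cos (a * t)) / t\<^sup>2)"
    and "(LBINT t:{0<..}. (1 - cos (a * t)) / t\<^sup>2) = pi * a / 2"
proof -
  let ?F = "\<lambda>t. a * Si (a * t) - (1 - cos (a * t)) / t"
  have D: "DERIV ?F t :> (1 - cos (a * t)) / t\<^sup>2" if "0 < t" for t
  proof -
    have "((\<lambda>t. Si (a * t)) has_real_derivative (sin (a * t) / (a * t) * a)) (at t)"
      using DERIV_chain2[where f = Si and g = "\<lambda>t. a * t" and x = t, OF DERIV_Si DERIV_cmult_Id] a that
      by simp
    then have "(?F has_real_derivative
        a * (sin (a * t) / (a * t) * a) - (sin (a * t) * a * t - (1 - cos (a * t))) / (t * t)) (at t)"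
      using that by (auto intro!: derivative_eq_intros)
    moreover have "a * (sin (a * t) / (a * t) * a) - (sin (a * t) * a * t - (1 - cos (a * t))) / (t * t) =
        (1 - cos (a * t)) / t\<^sup>2"
      using a that by (simp add: field_simps power2_eq_square)
    ultimately show ?thesis
      by simp
  qed
  have "((\<lambda>t. Si (a * t)) \<longlongrightarrow> Si (a * 0)) (at_right 0)"
    by (rule isCont_tendsto_compose[OF isCont_Si]) (auto intro!: tendsto_eq_intros)
  moreover have "((\<lambda>t. (1 - cos (a * t)) / t) \<longlongrightarrow> 0) (at_right 0)"
    using a by real_asymp
  ultimately have "(?F \<longlongrightarrow> a * Si (a * 0) - 0) (at_right 0)"
    by (intro tendsto_intros)
  then have A: "(?F \<longlongrightarrow> 0) (at_right 0)"
    by (simp add: Si_def zero_ereal_def[symmetric])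
  have "((\<lambda>t. Si (a * t)) \<longlongrightarrow> pi / 2) at_top"
    using a by (intro filterlim_compose[OF Si_at_top] filterlim_tendsto_pos_mult_at_top[OF tendsto_const])
      (auto simp: filterlim_ident)
  moreover have "((\<lambda>t. (1 - cos (a * t)) / t) \<longlongrightarrow> 0) at_top"
  proof (rule Lim_null_comparison)
    show "\<forall>\<^sub>F t in at_top. norm ((1 - cos (a * t)) / t) \<le> 2 / t"
      using eventually_gt_at_top[of 0]
    proof eventually_elim
      case (elim t)
      have "\<bar>1 - cos (a * t)\<bar> \<le> 2"
        using cos_ge_minus_one[of "a * t"] cos_le_one[of "a * t"] by linarith
      then show ?case
        using elim by (simp add: divide_right_mono)
    qed
    show "((\<lambda>t::real. 2 / t) \<longlongrightarrow> 0) at_top"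
      by real_asymp
  qed
  ultimately have B: "(?F \<longlongrightarrow> a * (pi / 2) - 0) at_top"
    by (intro tendsto_intros)
  have nonneg: "AE t in lborel. 0 < ereal t \<longrightarrow> ereal t < \<infinity> \<longrightarrow> 0 \<le> (1 - cos (a * t)) / t\<^sup>2"
    by simp
  have cont: "isCont (\<lambda>t. (1 - cos (a * t)) / t\<^sup>2) t" if "0 < t" for t
    using that by (intro continuous_intros) auto
  have A': "((?F \<circ> real_of_ereal) \<longlongrightarrow> 0) (at_right 0)"
    using A by (simp add: zero_ereal_def ereal_tendsto_simps)
  have B': "((?F \<circ> real_of_ereal) \<longlongrightarrow> a * (pi / 2) - 0) (at_left \<infinity>)"
    using B by (simp add: ereal_tendsto_simps)
  have "set_integrable lborel (einterval 0 \<infinity>) (\<lambda>t. (1 - cos (a * t)) / t\<^sup>2)"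
    and "(LBINT t=0..\<infinity>. (1 - cos (a * t)) / t\<^sup>2) = a * (pi / 2) - 0 - 0"
    using interval_integral_FTC_nonneg[OF _ _ _ nonneg A' B'] D cont by auto
  moreover have "einterval 0 \<infinity> = {0::real<..}"
    by (auto simp: einterval_def)
  ultimately show "set_integrable lborel {0<..} (\<lambda>t. (1 - cos (a * t)) / t\<^sup>2)"
    and "(LBINT t:{0<..}. (1 - cos (a * t)) / t\<^sup>2) = pi * a / 2"
    by (auto simp: interval_lebesgue_integral_def mult.commute)
qed

lemma one_minus_cos_over_square_integral:
  fixes a :: real
  shows "set_integrable lborel {0<..} (\<lambda>t. (1 - cos (a * t)) / t\<^sup>2)"
    and "(LBINT t:{0<..}. (1 - cos (a * t)) / t\<^sup>2) = pi * \<bar>a\<bar> / 2"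
proof -
  have abs: "cos (a * t) = cos (\<bar>a\<bar> * t)" for t
    by (cases "0 \<le> a") auto
  show "set_integrable lborel {0<..} (\<lambda>t. (1 - cos (a * t)) / t\<^sup>2)"
    and "(LBINT t:{0<..}. (1 - cos (a * t)) / t\<^sup>2) = pi * \<bar>a\<bar> / 2"
    using one_minus_cos_over_square_integral_pos[of "\<bar>a\<bar>"] unfolding abs
    by (cases "a = 0"; simp add: set_integrable_def set_lebesgue_integral_def)+
qed

text \<open>Up to normalisation the de la Vallee Poussin kernel of the line: the difference of the
  two Fejer kernels \<open>(1 - cos (2 * t)) / t\<^sup>2\<close> and
  \<open>(1 - cos t) / t\<^sup>2\<close>.\<close>

definition vp_kernel :: "real \<Rightarrow> real" where
  "vp_kernel t = (cos t - cos (2 * t)) / t\<^sup>2"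

text \<open>This is \<open>pi / 2\<close> times one minus the trapezoid.\<close>

definition vp_defect :: "real \<Rightarrow> real" where
  "vp_defect x = (LBINT t:{0<..}. vp_kernel t * (1 - cos (x * t)))"

text \<open>Product-to-sum formulas reduce everything to functions \<open>G a\<close> whose
  integrals are known. The form 1 - cos is kept because \<open>cos (a * t) / t\<^sup>2\<close> alone
  is not integrable at 0; the added constants cancel.\<close>

lemma vp_kernel_times_one_minus_cos:
  fixes t x :: real
  defines "G \<equiv> \<lambda>a. (1 - cos (a * t)) / t\<^sup>2"
  shows "vp_kernel t * (1 - cos (x * t)) =
    G 2 - G 1 - (G (2 + x) + G (2 - x) - G (1 + x) - G (1 - x)) / 2"
proof -
  have "cos (2 * t) * cos (x * t) = (cos ((2 - x) * t) + cos ((2 + x) * t)) / 2"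
    and "cos t * cos (x * t) = (cos ((1 - x) * t) + cos ((1 + x) * t)) / 2"
    using cos_minus[of "x * t - t * 2"] cos_minus[of "x * t - t"]
    by (simp_all add: cos_times_cos algebra_simps)
  then show ?thesis
    unfolding vp_kernel_def G_def
    by (simp add: divide_simps) (simp add: algebra_simps)
qed

lemma vp_kernel_one_minus_cos_integrable:
  "set_integrable lborel {0<..} (\<lambda>t. vp_kernel t * (1 - cos (x * t)))"
  unfolding vp_kernel_times_one_minus_cos
  by (intro set_integral_diff set_integral_add set_integrable_divide
      one_minus_cos_over_square_integral(1))

text \<open>For x at least 2 the four absolute values |2 + x|, |2 - x|, |1 + x|, |1 - x| cancel,
  leaving pi - pi/2. This vanishing of the trapezoid is what cuts the Taylor series off to a
  polynomial.\<close>

lemma vp_defect_eq: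
  assumes "2 \<le> x"
  shows "vp_defect x = pi / 2"
proof -
  have "vp_defect x = pi * 2 / 2 - pi * 1 / 2 -
    (pi * \<bar>2 + x\<bar> / 2 + pi * \<bar>2 - x\<bar> / 2 - pi * \<bar>1 + x\<bar> / 2 - pi * \<bar>1 - x\<bar> / 2) / 2"
    unfolding vp_defect_def vp_kernel_times_one_minus_cos
    using one_minus_cos_over_square_integral(1)
    by (simp only: set_integral_diff set_integral_add set_integrable_divide
        set_integral_divide_zero one_minus_cos_over_square_integral(2) abs_one abs_numeral)
  also have "\<dots> = pi / 2"
    using assms by (simp add: field_simps)
  finally show ?thesis .
qed

section \<open>Integrability of the weight in the Jackson constant\<close>

lemma abs_cos_diff_double_le: "\<bar>cos t - cos (2 * t)\<bar> \<le> 2 * t\<^sup>2" for t :: real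
proof -
  have le: "1 - cos x \<le> x\<^sup>2 / 2" for x :: real
    using cos_squared_eq[of "x / 2"] cos_double_sin[of "x / 2"] abs_sin_x_le_abs_x[of "x / 2"]
      power_mono[of "\<bar>sin (x / 2)\<bar>" "\<bar>x / 2\<bar>" 2] by (simp add: power_divide)
  \<comment> \<open>Both 1 - cos t and 1 - cos 2t are nonnegative, so their difference is at most
    the larger of the two bounds, (2t)^2 / 2.\<close>
  show ?thesis
    using le[of t] le[of "2 * t"] cos_le_one[of t] cos_le_one[of "2 * t"]
      zero_le_power2[of t] by (simp add: power_mult_distrib abs_le_iff; linarith)
qed

lemma abs_cos_diff_double_le_2: "\<bar>cos t - cos (2 * t)\<bar> \<le> 2" for t :: real
  using cos_le_one[of t] cos_le_one[of "2 * t"] cos_ge_minus_one[of t] cos_ge_minus_one[of "2 * t"]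
  by linarith

lemma set_integrable_powr_at_top:
  fixes a :: real
  assumes "a < - 1"
  shows "set_integrable lborel {1<..} (\<lambda>t. t powr a)"
proof -
  let ?F = "\<lambda>t::real. t powr (a + 1) / (a + 1)"
  have D: "DERIV ?F t :> t powr a" if "1 < t" for t
    using assms that by (auto intro!: derivative_eq_intros)
  have A: "(?F \<longlongrightarrow> 1 powr (a + 1) / (a + 1)) (at_right 1)"
    using assms by (intro tendsto_intros) auto
  have B: "(?F \<longlongrightarrow> 0) at_top"
    using assms by real_asymp
  have "set_integrable lborel (einterval 1 \<infinity>) (\<lambda>t. t powr a)"
    by (rule interval_integral_FTC_nonneg(1)[where F = ?F])
      (use A B D in \<open>auto simp: one_ereal_def ereal_tendsto_simps intro!: continuous_intros\<close>)
  moreover have "einterval 1 \<infinity> = {1::real<..}"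
    by (auto simp: einterval_def one_ereal_def)
  ultimately show ?thesis
    by simp
qed

text \<open>Near 0 the double zero of the cosine difference compensates 1/t^2; at infinity the
  exponent \<beta> - 2 is below -1. The case \<beta> = 0 is included because it gives the absolute
  integrability of the kernel itself.\<close>

lemma jackson_weight_integrable:
  fixes \<beta> :: real
  assumes "0 \<le> \<beta>" "\<beta> < 1"
  shows "set_integrable lborel {0<..} (\<lambda>t::real. \<bar>cos t - cos (2 * t)\<bar> * t powr (\<beta> - 2))"
proof -
  let ?w = "\<lambda>t::real. \<bar>cos t - cos (2 * t)\<bar> * t powr (\<beta> - 2)"
  have "set_integrable lborel {0<..1} (\<lambda>t::real. 2::real)"
    by (simp add: set_integrable_def)
  moreover have "(\<lambda>t. ?w t) \<in> borel_measurable borel"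
    by measurable
  moreover have "\<bar>?w t\<bar> \<le> 2" if "0 < t" "t \<le> 1" for t
  proof -
    have "\<bar>?w t\<bar> \<le> 2 * t\<^sup>2 * t powr (\<beta> - 2)"
      using abs_cos_diff_double_le[of t] by (simp add: abs_mult mult_right_mono)
    also have "\<dots> = 2 * t powr \<beta>"
      using that by (simp add: powr_diff powr_numeral)
    also have "t powr \<beta> \<le> 1"
      using that assms by (intro powr_le1) auto
    finally show ?thesis by simp
  qed
  ultimately have "set_integrable lborel {0<..1} ?w"
    by (elim set_integrable_bound) (auto simp: set_borel_measurable_def)
  moreover have "set_integrable lborel {1<..} ?w"
  proof (rule set_integrable_bound)
    show "set_integrable lborel {1<..} (\<lambda>t. 2 * t powr (\<beta> - 2))"
      using assms by (intro set_integrable_mult_right set_integrable_powr_at_top) auto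
  qed (auto simp: set_borel_measurable_def abs_mult mult_right_mono abs_cos_diff_double_le_2)
  ultimately have "set_integrable lborel ({0<..1} \<union> {1<..}) ?w"
    by (rule set_integrable_Un) auto
  also have "{0<..1} \<union> {1<..} = {0::real<..}"
    by auto
  finally show ?thesis .
qed

section \<open>Minkowski's inequality for integrals\<close>

text \<open>The absolute value extends the power to the whole line, so that Jensen's inequality can
  be applied with \<open>I = UNIV\<close> to norms that may vanish. If one of the two points is 0,
  convexity reduces to s^p \<le> s on (0, 1).\<close>

lemma convex_on_abs_powr:
  fixes p :: real
  assumes "1 \<le> p"
  shows "convex_on UNIV (\<lambda>x::real. \<bar>x\<bar> powr p)"
proof (rule convex_onI)
  fix t x y :: real
  assume t: "0 < t" "t < 1"
  have *: "((1 - t) * a + t * b) powr p \<le> (1 - t) * a powr p + t * b powr p" if "0 \<le> a" "0 \<le> b" for a b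
  proof -
    have small: "s powr p \<le> s" if "0 < s" "s < 1" for s :: real
      using powr_mono'[of 1 p s] that assms by simp
    consider "a = 0" | "b = 0" | "0 < a" "0 < b"
      using \<open>0 \<le> a\<close> \<open>0 \<le> b\<close> by linarith
    then show ?thesis
    proof cases
      case 1
      then show ?thesis
        using t small[of t] \<open>0 \<le> b\<close> assms by (simp add: powr_mult mult_right_mono)
    next
      case 2
      then show ?thesis
        using t small[of "1 - t"] \<open>0 \<le> a\<close> assms by (simp add: powr_mult mult_right_mono)
    next
      case 3
      then show ?thesis
        using convex_onD[OF powr_convex[OF assms], of t a b] t by simp
    qed
  qed
  have "\<bar>(1 - t) *\<^sub>R x + t *\<^sub>R y\<bar> \<le> (1 - t) * \<bar>x\<bar> + t * \<bar>y\<bar>"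
    using t abs_triangle_ineq[of "(1 - t) * x" "t * y"] by (simp add: abs_mult)
  then have "\<bar>(1 - t) *\<^sub>R x + t *\<^sub>R y\<bar> powr p \<le> ((1 - t) * \<bar>x\<bar> + t * \<bar>y\<bar>) powr p"
    using assms by (intro powr_mono2) auto
  also have "\<dots> \<le> (1 - t) * \<bar>x\<bar> powr p + t * \<bar>y\<bar> powr p"
    by (rule *) auto
  finally show "\<bar>(1 - t) *\<^sub>R x + t *\<^sub>R y\<bar> powr p \<le> (1 - t) * \<bar>x\<bar> powr p + t * \<bar>y\<bar> powr p" .
qed simp

text \<open>On a finite measure this puts L^p inside L^1.\<close>

lemma le_one_plus_powr:
  fixes a p :: real
  assumes "1 \<le> p" "0 \<le> a"
  shows "a \<le> 1 + a powr p"
proof (cases "a \<le> 1")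
  case False
  then have "a powr 1 \<le> a powr p"
    using assms by (intro powr_mono) auto
  then show ?thesis
    using False by simp
qed (use powr_ge_zero[of a p] in linarith)

text \<open>Jensen's inequality. With a nonnegative integral on the right no integrability has to be
  assumed, as an infinite value makes the claim trivial, and the result can be fed directly to
  Tonelli's theorem.\<close>

lemma (in prob_space) norm_expectation_powr_le:
  fixes X :: "'a \<Rightarrow> 'b::{banach, second_countable_topology}"
  assumes [measurable]: "X \<in> borel_measurable M" and p: "1 \<le> p"
  shows "ennreal (norm (expectation X) powr p) \<le> (\<integral>\<^sup>+x. ennreal (norm (X x) powr p) \<partial>M)"
proof (cases "(\<integral>\<^sup>+x. ennreal (norm (X x) powr p) \<partial>M) = \<infinity>")
  case False
  then have int: "integrable M (\<lambda>x. norm (X x) powr p)"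
    by (intro integrableI_nonneg) (auto simp: top.not_eq_extremum)
  have intX: "integrable M (\<lambda>x. norm (X x))"
  proof (rule Bochner_Integration.integrable_bound)
    show "integrable M (\<lambda>x. 1 + norm (X x) powr p)"
      using int by simp
    show "AE x in M. norm (norm (X x)) \<le> norm (1 + norm (X x) powr p)"
      using le_one_plus_powr[OF p] by (auto simp: abs_of_nonneg add_nonneg_nonneg)
  qed measurable
  have "norm (expectation X) powr p \<le> \<bar>expectation (\<lambda>x. norm (X x))\<bar> powr p"
    using p by (intro powr_mono2) (auto intro!: integral_norm_bound order_trans[OF _ abs_ge_self])
  also have "\<dots> \<le> expectation (\<lambda>x. \<bar>norm (X x)\<bar> powr p)"
    using int intX by (intro jensens_inequality[where I = UNIV]) (auto intro: convex_on_abs_powr p)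
  finally have "ennreal (norm (expectation X) powr p) \<le> ennreal (expectation (\<lambda>x. norm (X x) powr p))"
    by (simp add: ennreal_leI)
  also have "\<dots> = (\<integral>\<^sup>+x. ennreal (norm (X x) powr p) \<partial>M)"
    using int by (simp add: nn_integral_eq_integral)
  finally show ?thesis .
qed simp

text \<open>With a bound on the p-th powers that is uniform in x, Minkowski's inequality follows
  from Jensen's: m divided by its mass I is a probability density, and after Jensen in x, Tonelli
  exchanges the integrals. If x -> m x G x y is not integrable for some y, its Bochner integral is 0
  and the estimate at y still holds.\<close>

lemma weighted_Minkowski_inequality:
  fixes G :: "'a \<Rightarrow> 'b \<Rightarrow> 'c::{banach, second_countable_topology}"
  assumes M: "sigma_finite_measure M" and N: "sigma_finite_measure N"
    and p: "1 \<le> p"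
    and m: "integrable M m" "\<And>x. 0 \<le> m x"
    and G: "(\<lambda>(x, y). G x y) \<in> borel_measurable (M \<Otimes>\<^sub>M N)"
    and le: "\<And>x. x \<in> space M \<Longrightarrow> (\<integral>\<^sup>+y. ennreal (norm (G x y) powr p) \<partial>N) \<le> B"
  shows "(\<integral>\<^sup>+y. ennreal (norm (\<integral>x. m x *\<^sub>R G x y \<partial>M) powr p) \<partial>N) \<le> ennreal ((\<integral>x. m x \<partial>M) powr p) * B"
proof -
  define I where "I = (\<integral>x. m x \<partial>M)"
  have mm [measurable]: "m \<in> borel_measurable M"
    using m by auto
  have "0 \<le> I"
    unfolding I_def using m by simp
  show ?thesis
  proof (cases "I = 0")
    case True
    then have "AE x in M. m x = 0"
      using m integral_nonneg_eq_0_iff_AE[of M m] by (simp add: I_def)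
    then have "(\<integral>x. m x *\<^sub>R G x y \<partial>M) = 0" for y
      by (intro integral_eq_zero_AE) auto
    then show ?thesis
      by simp
  next
    case False
    then have I: "0 < I"
      using \<open>0 \<le> I\<close> by simp
    define M' where "M' = density M (\<lambda>x. ennreal (m x / I))"
    have sets [measurable_cong]: "sets M' = sets M" and space: "space M' = space M"
      by (auto simp: M'_def)
    interpret M': prob_space M'
    proof
      have "emeasure M' (space M') = (\<integral>\<^sup>+x. ennreal (m x / I) \<partial>M)"
        unfolding M'_def by (simp add: emeasure_density cong: nn_integral_cong)
      also have "\<dots> = ennreal (\<integral>x. m x / I \<partial>M)"
        using m I by (intro nn_integral_eq_integral) auto
      also have "\<dots> = 1"
        using I m by (simp add: I_def)
      finally show "emeasure M' (space M') = 1" .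
    qed
    interpret N: sigma_finite_measure N by fact
    interpret pair_sigma_finite M' N ..
    have G' [measurable]: "(\<lambda>(x, y). G x y) \<in> borel_measurable (M' \<Otimes>\<^sub>M N)"
      using G by (simp add: measurable_cong_sets[OF sets_pair_measure_cong[OF sets refl] refl])
    have Gy: "(\<lambda>x. G x y) \<in> borel_measurable M'" if "y \<in> space N" for y
      using measurable_Pair1[OF G' that] by simp
    have "ennreal (norm (\<integral>x. m x *\<^sub>R G x y \<partial>M) powr p) \<le>
        ennreal (I powr p) * (\<integral>\<^sup>+x. ennreal (norm (G x y) powr p) \<partial>M')" if y: "y \<in> space N" for y
    proof -
      have Gy [measurable]: "(\<lambda>x. G x y) \<in> borel_measurable M'"
        using y by (rule Gy)
      have "(\<lambda>x. G x y) \<in> borel_measurable M"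
        using Gy by (simp add: measurable_cong_sets[OF sets refl])
      then have "M'.expectation (\<lambda>x. G x y) = (\<integral>x. (m x / I) *\<^sub>R G x y \<partial>M)"
        unfolding M'_def using m I by (intro integral_density) auto
      also have "\<dots> = (\<integral>x. (1 / I) *\<^sub>R (m x *\<^sub>R G x y) \<partial>M)"
        by (simp add: divide_inverse mult.commute)
      also have "\<dots> = (1 / I) *\<^sub>R (\<integral>x. m x *\<^sub>R G x y \<partial>M)"
        by (rule integral_scaleR_right)
      finally have "(\<integral>x. m x *\<^sub>R G x y \<partial>M) = I *\<^sub>R M'.expectation (\<lambda>x. G x y)"
        using I by simp
      then have "norm (\<integral>x. m x *\<^sub>R G x y \<partial>M) powr p =
          I powr p * norm (M'.expectation (\<lambda>x. G x y)) powr p"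
        using I by (simp add: powr_mult)
      also have "ennreal \<dots> = ennreal (I powr p) * ennreal (norm (M'.expectation (\<lambda>x. G x y)) powr p)"
        by (simp add: ennreal_mult)
      also have "\<dots> \<le> ennreal (I powr p) * (\<integral>\<^sup>+x. ennreal (norm (G x y) powr p) \<partial>M')"
        by (intro mult_left_mono M'.norm_expectation_powr_le p) auto
      finally show ?thesis .
    qed
    then have "(\<integral>\<^sup>+y. ennreal (norm (\<integral>x. m x *\<^sub>R G x y \<partial>M) powr p) \<partial>N) \<le>
        (\<integral>\<^sup>+y. ennreal (I powr p) * (\<integral>\<^sup>+x. ennreal (norm (G x y) powr p) \<partial>M') \<partial>N)"
      by (intro nn_integral_mono) auto
    also have "\<dots> = ennreal (I powr p) * (\<integral>\<^sup>+y. (\<integral>\<^sup>+x. ennreal (norm (G x y) powr p) \<partial>M') \<partial>N)"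
      by (intro nn_integral_cmult) measurable
    also have "(\<integral>\<^sup>+y. (\<integral>\<^sup>+x. ennreal (norm (G x y) powr p) \<partial>M') \<partial>N) =
        (\<integral>\<^sup>+x. (\<integral>\<^sup>+y. ennreal (norm (G x y) powr p) \<partial>N) \<partial>M')"
      by (rule Fubini') measurable
    also have "\<dots> \<le> (\<integral>\<^sup>+x. B \<partial>M')"
      using le by (intro nn_integral_mono) (simp add: space)
    also have "\<dots> = B"
      by (simp add: M'.emeasure_space_1)
    finally show ?thesis
      by (simp add: I_def mult_left_mono)
  qed
qed

section \<open>Existence of best approximants\<close>

lemma norm_diff_powr_le:
  fixes a b :: "'a::real_normed_vector" and p :: real
  assumes "0 \<le> p"
  shows "norm (a - b) powr p \<le> 2 powr p * (norm a powr p + norm b powr p)"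
proof -
  have "norm (a - b) powr p \<le> (2 * max (norm a) (norm b)) powr p"
    using assms norm_triangle_ineq4[of a b] by (intro powr_mono2) auto
  also have "\<dots> = 2 powr p * max (norm a) (norm b) powr p"
    by (simp add: powr_mult)
  also have "\<dots> \<le> 2 powr p * (norm a powr p + norm b powr p)"
    by (intro mult_left_mono) (auto simp: max_def)
  finally show ?thesis .
qed

lemma integrable_disc_measure_bounded:
  fixes g :: "complex \<Rightarrow> 'a::{banach, second_countable_topology}"
  assumes "- 1 < \<alpha>" "continuous_on UNIV g"
  shows "integrable (disc_measure \<alpha>) g"
proof -
  interpret finite_measure "disc_measure \<alpha>"
    using assms(1) by (rule finite_measure_disc_measure)
  have "bounded (g ` cball 0 1)"
    using assms by (intro compact_imp_bounded compact_continuous_image)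
      (auto intro: continuous_on_subset)
  then obtain b where b: "\<And>z. z \<in> cball 0 1 \<Longrightarrow> norm (g z) \<le> b"
    by (metis bounded_iff image_eqI)
  show ?thesis
  proof (rule integrable_const_bound)
    show "AE z in disc_measure \<alpha>. norm (g z) \<le> b"
      using b by (intro AE_I2) auto
    show "g \<in> borel_measurable (disc_measure \<alpha>)"
      using assms by (intro continuous_on_imp_measurable_disc_measure) (auto intro: continuous_on_subset)
  qed
qed

section \<open>Orthogonality of monomials and bounds on coefficients\<close>

lemma integral_monomials_orthogonal:
  assumes "i \<noteq> j"
  shows "(\<integral>z. z ^ i * cnj z ^ j \<partial>disc_measure \<alpha>) = 0"
proof -
  \<comment> \<open>Rotation by this angle multiplies the integrand by cis pi = -1, so the integral
    equals its own negative.\<close>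
  define t where "t = pi / (real i - real j)"
  have "cis t ^ i * cnj (cis t) ^ j = cis (t * (real i - real j))"
    by (simp add: cis_cnj Complex.DeMoivre cis_mult algebra_simps)
  also have "\<dots> = - 1"
    using assms by (simp add: t_def cis_pi)
  finally have t: "cis t ^ i * cnj (cis t) ^ j = - 1" .
  have "(\<integral>z. z ^ i * cnj z ^ j \<partial>disc_measure \<alpha>) =
      (\<integral>z. (cis t * z) ^ i * cnj (cis t * z) ^ j \<partial>disc_measure \<alpha>)"
    by (rule integral_disc_measure_cis[symmetric])
      (intro continuous_on_imp_measurable_disc_measure continuous_intros)
  also have "\<dots> = (\<integral>z. (cis t ^ i * cnj (cis t) ^ j) * (z ^ i * cnj z ^ j) \<partial>disc_measure \<alpha>)"
    by (simp add: power_mult_distrib mult_ac)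
  also have "\<dots> = - (\<integral>z. z ^ i * cnj z ^ j \<partial>disc_measure \<alpha>)"
    unfolding t by simp
  finally show ?thesis
    by simp
qed

text \<open>The density is positive throughout the disc; a vanishing integral would therefore make
  the disc without its centre a null set, although it has area pi.\<close>

lemma integral_norm_power_pos:
  assumes "- 1 < \<alpha>"
  shows "0 < (\<integral>z. norm z ^ j \<partial>disc_measure \<alpha>)"
proof -
  have int: "integrable (disc_measure \<alpha>) (\<lambda>z. norm z ^ j)"
    using assms by (intro integrable_disc_measure_bounded continuous_intros) 
  have "(\<integral>z. norm z ^ j \<partial>disc_measure \<alpha>) \<noteq> 0"
  proof
    assume "(\<integral>z. norm z ^ j \<partial>disc_measure \<alpha>) = 0"
    then have "AE z in disc_measure \<alpha>. norm z ^ j = 0"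
      using int by (subst (asm) integral_nonneg_eq_0_iff_AE) auto
    moreover have "0 < (\<alpha> + 1) / pi * (1 - (norm z)\<^sup>2) powr \<alpha>" if "norm z < 1" for z :: complex
    proof -
      have "(norm z)\<^sup>2 < 1"
        using that by (simp add: power_less_one_iff)
      then show ?thesis
        using assms by (simp add: mult_pos_pos)
    qed
    ultimately have "AE z in lborel. z \<in> ball 0 1 \<longrightarrow> z = (0::complex)"
      unfolding disc_measure_def
      by (subst (asm) AE_density)
        (auto simp: AE_restrict_space_iff power_less_one_iff intro!: measurable_restrict_space1 elim!: eventually_mono)
    moreover have "AE z in lborel. z \<noteq> (0::complex)"
      by (rule AE_lborel_singleton)
    ultimately have "AE z in lborel. z \<notin> ball (0::complex) 1"
      by eventually_elim auto
    then have "emeasure lborel (ball (0::complex) 1) = 0"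
      by (subst (asm) AE_iff_measurable[of "ball 0 1"]) auto
    then show False
      by (simp add: emeasure_ball unit_ball_vol_2)
  qed
  moreover have "0 \<le> (\<integral>z. norm z ^ j \<partial>disc_measure \<alpha>)"
    by simp
  ultimately show ?thesis
    by linarith
qed

text \<open>By orthogonality, integrating P against \<open>cnj z ^ j\<close> isolates the j-th
  coefficient, and this test function is bounded by 1 on the disc. So an L^1 bound on a polynomial
  bounds each of its coefficients.\<close>

lemma norm_coeff_le_integral:
  assumes \<alpha>: "- 1 < \<alpha>"
  shows "norm (coeff P j) * (\<integral>z. norm z ^ (2 * j) \<partial>disc_measure \<alpha>) \<le> (\<integral>z. norm (poly P z) \<partial>disc_measure \<alpha>)"
proof -
  note int = integrable_disc_measure_bounded[OF \<alpha>]
  let ?c = "\<integral>z. norm z ^ (2 * j) \<partial>disc_measure \<alpha>"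
  have sq: "z ^ j * cnj z ^ j = of_real (norm z ^ (2 * j))" for z
    by (simp only: power_mult_distrib[symmetric] complex_norm_square[symmetric] power_mult of_real_power)
  have "(\<integral>z. poly P z * cnj z ^ j \<partial>disc_measure \<alpha>) =
      (\<integral>z. (\<Sum>i\<le>degree P. coeff P i * (z ^ i * cnj z ^ j)) \<partial>disc_measure \<alpha>)"
    by (simp add: poly_altdef sum_distrib_right mult.assoc)
  also have "\<dots> = (\<Sum>i\<le>degree P. coeff P i * (\<integral>z. z ^ i * cnj z ^ j \<partial>disc_measure \<alpha>))"
    by (subst Bochner_Integration.integral_sum) (auto intro!: int continuous_intros)
  also have "\<dots> = (\<Sum>i\<le>degree P. if i = j then coeff P j * of_real ?c else 0)"
  proof (rule sum.cong)
    fix i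
    show "coeff P i * (\<integral>z. z ^ i * cnj z ^ j \<partial>disc_measure \<alpha>) = (if i = j then coeff P j * of_real ?c else 0)"
      using integral_monomials_orthogonal[of i j \<alpha>] by (auto simp: sq simp del: of_real_power)
  qed simp
  \<comment> \<open>For j beyond the degree the sum has no matching term, but then the coefficient
    is 0 as well.\<close>
  also have "\<dots> = coeff P j * of_real ?c"
    by (auto simp: coeff_eq_0 not_le)
  finally have "norm (coeff P j) * ?c = norm (\<integral>z. poly P z * cnj z ^ j \<partial>disc_measure \<alpha>)"
    by (simp add: norm_mult)
  also have "\<dots> \<le> (\<integral>z. norm (poly P z * cnj z ^ j) \<partial>disc_measure \<alpha>)"
    by (rule integral_norm_bound)
  also have "\<dots> \<le> (\<integral>z. norm (poly P z) \<partial>disc_measure \<alpha>)"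
    by (intro integral_mono int continuous_intros)
      (auto simp: norm_mult norm_power intro!: mult_left_le power_le_one)
  finally show ?thesis .
qed

lemma bergman_space_diff_poly_integrable:
  assumes "0 < p" "- 1 < \<alpha>" "f \<in> bergman_space p \<alpha>"
  shows "integrable (disc_measure \<alpha>) (\<lambda>z. norm (f z - poly P z) powr p)"
proof (rule Bochner_Integration.integrable_bound)
  have f: "f holomorphic_on ball 0 1" "integrable (disc_measure \<alpha>) (\<lambda>z. norm (f z) powr p)"
    using assms by (auto simp: bergman_space_def)
  have c: "continuous_on (ball 0 1) f"
    using f by (intro holomorphic_on_imp_continuous_on)
  have [measurable]: "(\<lambda>z. f z - poly P z) \<in> borel_measurable (disc_measure \<alpha>)"
    by (intro continuous_on_imp_measurable_disc_measure continuous_intros c)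
  show "integrable (disc_measure \<alpha>) (\<lambda>z. 2 powr p * (norm (f z) powr p + norm (poly P z) powr p))"
    using assms by (intro integrable_mult_right Bochner_Integration.integrable_add f(2) integrable_disc_measure_bounded)
      (auto intro!: continuous_intros continuous_on_powr')
  show "(\<lambda>z. norm (f z - poly P z) powr p) \<in> borel_measurable (disc_measure \<alpha>)"
    by measurable
  show "AE z in disc_measure \<alpha>. norm (norm (f z - poly P z) powr p) \<le>
      norm (2 powr p * (norm (f z) powr p + norm (poly P z) powr p))"
    using norm_diff_powr_le[of p] \<open>0 < p\<close> by (intro AE_I2) (auto simp: abs_mult abs_of_nonneg add_nonneg_nonneg)
qed

lemma poly_subseq_convergent:
  fixes P :: "nat \<Rightarrow> 'a::{real_normed_field, heine_borel} poly"
  assumes deg: "\<And>k. degree (P k) \<le> n" and b: "\<And>k j. j \<le> n \<Longrightarrow> norm (coeff (P k) j) \<le> b"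
  obtains r Q where "strict_mono r" "degree Q \<le> n" "\<And>z. (\<lambda>k. poly (P (r k)) z) \<longlonglongrightarrow> poly Q z"
proof -
  obtain r where r: "strict_mono r"
    and lim: "\<And>j. j \<in> {..n} \<Longrightarrow> \<exists>l. (\<lambda>k. coeff (P (r k)) j) \<longlonglongrightarrow> l"
    using function_convergent_subsequence[of "{..n}" "\<lambda>k. coeff (P k)" b] b by auto
  obtain l where l: "\<And>j. j \<le> n \<Longrightarrow> (\<lambda>k. coeff (P (r k)) j) \<longlonglongrightarrow> l j"
    using lim by (metis atMost_iff)
  define Q where "Q = (\<Sum>j\<le>n. monom (l j) j)"
  have "degree Q \<le> n"
    unfolding Q_def by (intro degree_sum_le) (auto intro: order_trans[OF degree_monom_le])
  moreover have "(\<lambda>k. poly (P (r k)) z) \<longlonglongrightarrow> poly Q z" for z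
  proof -
    have "(\<lambda>k. \<Sum>j\<le>n. coeff (P (r k)) j * z ^ j) \<longlonglongrightarrow> (\<Sum>j\<le>n. l j * z ^ j)"
      by (intro tendsto_sum tendsto_mult l tendsto_const) auto
    moreover have "poly (P k) z = (\<Sum>j\<le>n. coeff (P k) j * z ^ j)" for k
      unfolding poly_altdef using deg[of k]
      by (intro sum.mono_neutral_left) (auto simp: coeff_eq_0)
    ultimately show ?thesis
      by (simp add: Q_def poly_sum poly_monom)
  qed
  ultimately show ?thesis
    using that r by blast
qed

text \<open>The direct method: a minimising sequence is bounded in L^1, hence in its coefficients; a
  subsequence converges pointwise to a polynomial Q, and Fatou's lemma shows that Q attains the
  infimum. The p-th power \<Phi> of the norm is minimised, which is equivalent by
  monotonicity.\<close>

lemma best_approximant_exists: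
  assumes p: "1 \<le> p" and \<alpha>: "- 1 < \<alpha>" and f: "f \<in> bergman_space p \<alpha>"
  obtains P :: "complex poly" where "degree P \<le> n"
    "\<And>Q :: complex poly. degree Q \<le> n \<Longrightarrow>
      bergman_norm p \<alpha> (\<lambda>z. f z - poly P z) \<le> bergman_norm p \<alpha> (\<lambda>z. f z - poly Q z)"
proof -
  let ?D = "disc_measure \<alpha>"
  define \<Phi> where "\<Phi> = (\<lambda>Q :: complex poly. \<integral>z. norm (f z - poly Q z) powr p \<partial>?D)"
  define m where "m = Inf (\<Phi> ` {Q. degree Q \<le> n})"
  have int: "integrable ?D (\<lambda>z. norm (f z - poly Q z) powr p)" for Q
    using assms by (intro bergman_space_diff_poly_integrable) auto
  have nn: "(\<integral>\<^sup>+z. ennreal (norm (f z - poly Q z) powr p) \<partial>?D) = ennreal (\<Phi> Q)" for Q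
    unfolding \<Phi>_def by (intro nn_integral_eq_integral int) auto
  have \<Phi>_nonneg: "0 \<le> \<Phi> Q" for Q
    by (simp add: \<Phi>_def)
  have ne: "\<Phi> ` {Q. degree Q \<le> n} \<noteq> {}"
    using degree_0 by (metis (mono_tags) empty_iff image_eqI mem_Collect_eq zero_le)
  have bdd: "bdd_below (\<Phi> ` {Q. degree Q \<le> n})"
    using \<Phi>_nonneg by (intro bdd_belowI[of _ 0]) auto
  have "\<exists>Q. degree Q \<le> n \<and> \<Phi> Q < m + 1 / (real k + 1)" for k
    using cInf_lessD[OF ne, of "m + 1 / (real k + 1)"] by (auto simp: m_def[symmetric])
  then obtain P where degP: "\<And>k. degree (P k) \<le> n" and P: "\<And>k. \<Phi> (P k) < m + 1 / (real k + 1)"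
    by metis
  have \<Phi>_le: "\<Phi> (P k) \<le> m + 1" for k
  proof -
    have "1 / (real k + 1) \<le> 1"
      by simp
    then show ?thesis
      using P[of k] by linarith
  qed
  \<comment> \<open>A bound for the L^1 norms of all \<open>P k\<close>: |P| \<le> 1 + |P|^p, and P
    = f - (f - P) with both p-th powers under control.\<close>
  define b where "b = (\<integral>z. 1 \<partial>?D) + 2 powr p * ((\<integral>z. norm (f z) powr p \<partial>?D) + (m + 1))"
  have intf: "integrable ?D (\<lambda>z. norm (f z) powr p)"
    using f by (simp add: bergman_space_def)
  have intc: "integrable ?D (\<lambda>z. 1 :: real)"
    by (intro integrable_disc_measure_bounded \<alpha> continuous_intros)
  have b: "(\<integral>z. norm (poly (P k) z) \<partial>?D) \<le> b" for k
  proof -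
    have "(\<integral>z. norm (poly (P k) z) \<partial>?D) \<le>
        (\<integral>z. 1 + 2 powr p * (norm (f z) powr p + norm (f z - poly (P k) z) powr p) \<partial>?D)"
    proof (rule integral_mono)
      show "integrable ?D (\<lambda>z. norm (poly (P k) z))"
        by (intro integrable_disc_measure_bounded \<alpha> continuous_intros)
      show "integrable ?D (\<lambda>z. 1 + 2 powr p * (norm (f z) powr p + norm (f z - poly (P k) z) powr p))"
        by (intro Bochner_Integration.integrable_add integrable_mult_right intc intf int)
      fix z
      show "norm (poly (P k) z) \<le> 1 + 2 powr p * (norm (f z) powr p + norm (f z - poly (P k) z) powr p)"
        using le_one_plus_powr[OF p, of "norm (poly (P k) z)"]
          norm_diff_powr_le[of p "f z" "f z - poly (P k) z"] p by simp
    qed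
    also have "\<dots> = (\<integral>z. 1 \<partial>?D) + 2 powr p * ((\<integral>z. norm (f z) powr p \<partial>?D) + \<Phi> (P k))"
      unfolding \<Phi>_def using intc intf int[of "P k"] by simp
    also have "\<dots> \<le> b"
      unfolding b_def using \<Phi>_le[of k] by (intro add_left_mono mult_left_mono) auto
    finally show ?thesis .
  qed
  define c where "c = (\<lambda>j. \<integral>z. norm z ^ (2 * j) \<partial>?D)"
  have c: "0 < c j" for j
    unfolding c_def by (rule integral_norm_power_pos[OF \<alpha>])
  \<comment> \<open>Subsequence extraction wants one bound for all indices; the sum of the
    individual bounds serves.\<close>
  have "norm (coeff (P k) j) \<le> (\<Sum>j\<le>n. b / c j)" if "j \<le> n" for k j
  proof -
    have "norm (coeff (P k) i) \<le> b / c i" for i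
      using order_trans[OF norm_coeff_le_integral[OF \<alpha>, of "P k" i] b[of k]] c[of i]
      by (simp add: c_def pos_le_divide_eq)
    then have "0 \<le> b / c i" for i
      using norm_ge_zero order_trans by blast
    then have "b / c j \<le> (\<Sum>j\<le>n. b / c j)"
      using that by (intro member_le_sum) auto
    then show ?thesis
      using \<open>norm (coeff (P k) j) \<le> b / c j\<close> by linarith
  qed
  then obtain r Q where r: "strict_mono r" and Q: "degree Q \<le> n"
    and lim: "\<And>z. (\<lambda>k. poly (P (r k)) z) \<longlonglongrightarrow> poly Q z"
    using poly_subseq_convergent[of P n] degP by metis
  have f_meas: "f \<in> borel_measurable ?D"
    using f by (intro continuous_on_imp_measurable_disc_measure holomorphic_on_imp_continuous_on)
      (simp add: bergman_space_def)
  have [measurable]: "(\<lambda>z. f z - poly Q z) \<in> borel_measurable ?D" for Q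
    by (intro borel_measurable_diff f_meas continuous_on_imp_measurable_disc_measure continuous_intros)
  have "(\<lambda>k. 1 / (real (r k) + 1)) \<longlonglongrightarrow> 0"
    using LIMSEQ_subseq_LIMSEQ[OF LIMSEQ_inverse_real_of_nat r]
    by (simp add: comp_def inverse_eq_divide add.commute)
  then have "(\<lambda>k. m + 1 / (real (r k) + 1)) \<longlonglongrightarrow> m + 0"
    by (intro tendsto_intros)
  then have "(\<lambda>k. ennreal (m + 1 / (real (r k) + 1))) \<longlonglongrightarrow> ennreal m"
    by (auto intro: tendsto_ennrealI)
  then have lim_m: "liminf (\<lambda>k. ennreal (m + 1 / (real (r k) + 1))) = ennreal m"
    by (rule lim_imp_Liminf[OF sequentially_bot])
  have "(\<lambda>k. ennreal (norm (f z - poly (P (r k)) z) powr p)) \<longlonglongrightarrow> ennreal (norm (f z - poly Q z) powr p)" for z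
    using p by (intro tendsto_ennrealI tendsto_powr' tendsto_intros lim) auto
  then have "liminf (\<lambda>k. ennreal (norm (f z - poly (P (r k)) z) powr p)) = ennreal (norm (f z - poly Q z) powr p)" for z
    by (rule lim_imp_Liminf[OF sequentially_bot])
  then have "ennreal (\<Phi> Q) = (\<integral>\<^sup>+z. liminf (\<lambda>k. ennreal (norm (f z - poly (P (r k)) z) powr p)) \<partial>?D)"
    by (simp add: nn)
  also have "\<dots> \<le> liminf (\<lambda>k. \<integral>\<^sup>+z. ennreal (norm (f z - poly (P (r k)) z) powr p) \<partial>?D)"
    by (intro nn_integral_liminf) measurable
  also have "\<dots> \<le> liminf (\<lambda>k. ennreal (m + 1 / (real (r k) + 1)))"
    unfolding nn by (intro Liminf_mono always_eventually allI ennreal_leI less_imp_le P)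
  also have "\<dots> = ennreal m"
    by (rule lim_m)
  finally have "\<Phi> Q \<le> m"
    using cInf_greatest[OF ne, of 0] \<Phi>_nonneg by (subst (asm) ennreal_le_iff) (auto simp: m_def)
  then have "\<Phi> Q \<le> \<Phi> R" if "degree R \<le> n" for R
    using cInf_lower[OF _ bdd, of "\<Phi> R"] that by (auto simp: m_def)
  then have "bergman_norm p \<alpha> (\<lambda>z. f z - poly Q z) \<le> bergman_norm p \<alpha> (\<lambda>z. f z - poly R z)" if "degree R \<le> n" for R
    unfolding bergman_norm_def using that p \<Phi>_nonneg
    by (intro powr_mono2) (auto simp: \<Phi>_def)
  then show ?thesis
    using that Q by blast
qed

text \<open>Existence of a minimiser is what identifies the \<open>LEAST\<close> in
  \<open>best_approx\<close> with an actual minimum.\<close>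

lemma best_approx_le:
  fixes P :: "complex poly"
  assumes "1 \<le> p" "- 1 < \<alpha>" "f \<in> bergman_space p \<alpha>" "degree P \<le> n"
  shows "best_approx n p \<alpha> f \<le> bergman_norm p \<alpha> (\<lambda>z. f z - poly P z)"
proof -
  obtain Q :: "complex poly" where Q: "degree Q \<le> n"
    "\<And>R :: complex poly. degree R \<le> n \<Longrightarrow>
      bergman_norm p \<alpha> (\<lambda>z. f z - poly Q z) \<le> bergman_norm p \<alpha> (\<lambda>z. f z - poly R z)"
    using best_approximant_exists[OF assms(1-3)] by blast
  then have "best_approx n p \<alpha> f = bergman_norm p \<alpha> (\<lambda>z. f z - poly Q z)"
    unfolding best_approx_def by (intro Least_equality) auto
  then show ?thesis
    using Q assms by simp
qed

section \<open>The approximating polynomial\<close>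

lemma summable_norm_Taylor:
  assumes f: "f holomorphic_on ball 0 1" and z: "z \<in> ball 0 1"
  shows "summable (\<lambda>k. norm ((deriv ^^ k) f 0 / fact k * z ^ k))"
proof (rule powser_insidea)
  \<comment> \<open>A point of the disc farther from 0 than z: convergence there forces absolute
    convergence at z.\<close>
  define x :: complex where "x = of_real ((1 + norm z) / 2)"
  have x: "norm x = (1 + norm z) / 2"
    unfolding x_def norm_of_real by simp
  then have "x \<in> ball 0 1" "norm z < norm x"
    using z by auto
  then show "norm z < norm x" "summable (\<lambda>k. (deriv ^^ k) f 0 / fact k * x ^ k)"
    using holomorphic_power_series[OF f, of x] by (auto dest: sums_summable)
qed

text \<open>Rotations act diagonally on Taylor coefficients, so the second difference is the
  multiplier cis(kt) + cis(-kt) - 2 = -2 (1 - cos kt).\<close>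

lemma rot_diff2_sums:
  fixes t :: real
  assumes f: "f holomorphic_on ball 0 1" and z: "z \<in> ball 0 1"
  shows "(\<lambda>k. - 2 * of_real (1 - cos (real k * t)) * ((deriv ^^ k) f 0 / fact k * z ^ k)) sums rot_diff2 f t z"
proof -
  have s: "(\<lambda>k. (deriv ^^ k) f 0 / fact k * w ^ k) sums f w" if "norm w < 1" for w
    using holomorphic_power_series[OF f, of w] that by simp
  have "(\<lambda>k. (deriv ^^ k) f 0 / fact k * (cis t * z) ^ k + (deriv ^^ k) f 0 / fact k * (cis (- t) * z) ^ k
      - 2 * ((deriv ^^ k) f 0 / fact k * z ^ k)) sums rot_diff2 f t z"
    unfolding rot_diff2_def using z by (intro sums_add sums_diff sums_mult s) (auto simp: norm_mult)
  moreover have "(deriv ^^ k) f 0 / fact k * (cis t * z) ^ k + (deriv ^^ k) f 0 / fact k * (cis (- t) * z) ^ k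
      - 2 * ((deriv ^^ k) f 0 / fact k * z ^ k) =
      - 2 * of_real (1 - cos (real k * t)) * ((deriv ^^ k) f 0 / fact k * z ^ k)" for k
  proof -
    have "cis t ^ k + cis (- t) ^ k = 2 * of_real (cos (real k * t))"
      by (simp add: Complex.DeMoivre complex_eq_iff)
    then have "a * (cis t ^ k + cis (- t) ^ k - 2) = - 2 * of_real (1 - cos (real k * t)) * a" for a
      by (simp only: of_real_diff of_real_1) (simp add: algebra_simps)
    from this[of "(deriv ^^ k) f 0 / fact k * z ^ k"] show ?thesis
      by (simp only: power_mult_distrib) (simp only: algebra_simps)
  qed
  ultimately show ?thesis
    by simp
qed

lemma abs_vp_kernel:
  assumes "0 < t"
  shows "\<bar>vp_kernel t\<bar> = \<bar>cos t - cos (2 * t)\<bar> * t powr (- 2)"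
  using assms by (simp add: vp_kernel_def powr_minus powr_numeral divide_inverse abs_mult)

lemma vp_kernel_borel_measurable [measurable]: "vp_kernel \<in> borel_measurable borel"
  unfolding vp_kernel_def by measurable

text \<open>Sum and integral may be exchanged because the k-th term is dominated by 4 |a k| |w t|, a
  summable sequence times an integrable function. Each term then integrates to a value of
  \<open>vp_defect\<close>, at k times the scale h.\<close>

lemma vp_kernel_integral_rot_diff2:
  fixes h :: real
  assumes f: "f holomorphic_on ball 0 1" and z: "z \<in> ball 0 1"
  shows "(\<lambda>k. of_real (- 2 * vp_defect (real k * h)) * ((deriv ^^ k) f 0 / fact k * z ^ k)) sums
    (\<integral>t. (indicator {0<..} t * vp_kernel t) *\<^sub>R rot_diff2 f (h * t) z \<partial>lborel)"
proof -
  define a where "a = (\<lambda>k. (deriv ^^ k) f 0 / fact k * z ^ k)"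
  define w where "w = (\<lambda>t. indicator {0<..} t * vp_kernel t)"
  define g where "g = (\<lambda>k t. (w t * (1 - cos (real k * h * t))) *\<^sub>R (- 2 * a k))"
  have a: "summable (\<lambda>k. norm (a k))"
    unfolding a_def by (rule summable_norm_Taylor[OF f z])
  have "set_integrable lborel {0<..} (\<lambda>t. \<bar>vp_kernel t\<bar>)"
  proof -
    \<comment> \<open>The exponent \<open>0 - 2\<close> is that of the Jackson weight at \<beta> =
      0.\<close>
    have eq: "indicator {0<..} t *\<^sub>R \<bar>vp_kernel t\<bar> =
        indicator {0<..} t *\<^sub>R (\<bar>cos t - cos (2 * t)\<bar> * t powr (0 - 2))" for t
      by (cases "0 < t") (auto simp: abs_vp_kernel)
    have "set_integrable lborel {0<..} (\<lambda>t::real. \<bar>cos t - cos (2 * t)\<bar> * t powr (0 - 2))"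
      by (intro jackson_weight_integrable) auto
    then show ?thesis
      unfolding set_integrable_def eq .
  qed
  then have w: "integrable lborel (\<lambda>t. \<bar>w t\<bar>)"
    by (simp add: set_integrable_def w_def abs_mult)
  have w_cos: "integrable lborel (\<lambda>t. w t * (1 - cos (x * t)))" for x
    using vp_kernel_one_minus_cos_integrable[of x] by (simp add: set_integrable_def w_def mult.assoc)
  have g: "integrable lborel (g k)" for k
    unfolding g_def by (intro integrable_scaleR_left w_cos)
  have norm_g: "norm (g k t) \<le> 4 * norm (a k) * \<bar>w t\<bar>" for k t
  proof -
    have "\<bar>1 - cos (real k * h * t)\<bar> \<le> 2"
      using cos_ge_minus_one[of "real k * h * t"] cos_le_one[of "real k * h * t"] by linarith
    then have "\<bar>w t\<bar> * \<bar>1 - cos (real k * h * t)\<bar> * (2 * norm (a k)) \<le> \<bar>w t\<bar> * 2 * (2 * norm (a k))"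
      by (intro mult_right_mono mult_left_mono) auto
    then show ?thesis
      by (simp add: g_def norm_mult abs_mult mult_ac)
  qed
  have "AE t in lborel. summable (\<lambda>k. norm (g k t))"
    using norm_g by (intro AE_I2 summable_comparison_test'[OF summable_mult2[OF summable_mult[OF a]]]) auto
  moreover have "summable (\<lambda>k. \<integral>t. norm (g k t) \<partial>lborel)"
  proof (rule summable_comparison_test')
    show "summable (\<lambda>k. 4 * norm (a k) * (\<integral>t. \<bar>w t\<bar> \<partial>lborel))"
      by (intro summable_mult2 summable_mult a)
    fix k
    have "(\<integral>t. norm (g k t) \<partial>lborel) \<le> (\<integral>t. 4 * norm (a k) * \<bar>w t\<bar> \<partial>lborel)"
      using norm_g g w by (intro integral_mono) auto
    then show "norm (\<integral>t. norm (g k t) \<partial>lborel) \<le> 4 * norm (a k) * (\<integral>t. \<bar>w t\<bar> \<partial>lborel)"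
      by simp
  qed
  ultimately have "(\<lambda>k. integral\<^sup>L lborel (g k)) sums (\<integral>t. (\<Sum>k. g k t) \<partial>lborel)"
    using g by (intro sums_integral)
  also have "(\<lambda>t. \<Sum>k. g k t) = (\<lambda>t. w t *\<^sub>R rot_diff2 f (h * t) z)"
  proof
    fix t
    have "(\<lambda>k. w t *\<^sub>R (- 2 * of_real (1 - cos (real k * (h * t))) * a k)) sums (w t *\<^sub>R rot_diff2 f (h * t) z)"
      unfolding a_def by (intro sums_scaleR_right rot_diff2_sums f z)
    also have "(\<lambda>k. w t *\<^sub>R (- 2 * of_real (1 - cos (real k * (h * t))) * a k)) = (\<lambda>k. g k t)"
      by (simp add: g_def scaleR_conv_of_real algebra_simps)
    finally show "(\<Sum>k. g k t) = w t *\<^sub>R rot_diff2 f (h * t) z"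
      by (rule sums_unique[symmetric])
  qed
  also have "(\<lambda>k. integral\<^sup>L lborel (g k)) = (\<lambda>k. of_real (- 2 * vp_defect (real k * h)) * a k)"
  proof
    fix k
    have "integral\<^sup>L lborel (g k) = (\<integral>t. w t * (1 - cos (real k * h * t)) \<partial>lborel) *\<^sub>R (- 2 * a k)"
      unfolding g_def by (rule integral_scaleR_left) (rule w_cos)
    then show "integral\<^sup>L lborel (g k) = of_real (- 2 * vp_defect (real k * h)) * a k"
      by (simp add: vp_defect_def set_lebesgue_integral_def w_def mult.assoc scaleR_conv_of_real)
  qed
  finally show ?thesis
    by (simp add: a_def w_def)
qed

text \<open>The factor \<open>1 - 2 / pi * vp_defect\<close> is the trapezoid itself. With the scale
  2/n its argument reaches 2 exactly at k = n, hence the range k < n.\<close>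

definition vp_poly :: "nat \<Rightarrow> (complex \<Rightarrow> complex) \<Rightarrow> complex poly" where
  "vp_poly n f = (\<Sum>k<n. monom (of_real (1 - 2 / pi * vp_defect (real k * (2 / real n))) * ((deriv ^^ k) f 0 / fact k)) k)"

lemma degree_vp_poly_le: "degree (vp_poly n f) \<le> n"
  unfolding vp_poly_def by (intro degree_sum_le) (auto intro: order_trans[OF degree_monom_le])

lemma diff_vp_poly_eq:
  assumes f: "f holomorphic_on ball 0 1" and z: "z \<in> ball 0 1"
    and n: "1 \<le> n"
  shows "f z - poly (vp_poly n f) z =
    - (1 / pi) *\<^sub>R (\<integral>t. (indicator {0<..} t * vp_kernel t) *\<^sub>R rot_diff2 f (2 / n * t) z \<partial>lborel)"
    (is "_ = - (1 / pi) *\<^sub>R ?I")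
proof -
  define a where "a = (\<lambda>k. (deriv ^^ k) f 0 / fact k * z ^ k)"
  define c where "c = (\<lambda>k. 1 - 2 / pi * vp_defect (real k * (2 / real n)))"
  have "(\<lambda>k. - (1 / pi) *\<^sub>R (of_real (- 2 * vp_defect (real k * (2 / real n))) * a k)) sums (- (1 / pi) *\<^sub>R ?I)"
    unfolding a_def by (intro sums_scaleR_right vp_kernel_integral_rot_diff2 f z)
  moreover have "a sums f z"
    unfolding a_def using holomorphic_power_series[OF f z] by simp
  \<comment> \<open>Subtracting the claimed error from f leaves a series with multipliers
    \<open>c k\<close>, which vanish from k = n on, so its sum is the polynomial.\<close>
  ultimately have "(\<lambda>k. a k - - (1 / pi) *\<^sub>R (of_real (- 2 * vp_defect (real k * (2 / real n))) * a k)) sums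
      (f z - - (1 / pi) *\<^sub>R ?I)"
    by (intro sums_diff)
  also have "(\<lambda>k. a k - - (1 / pi) *\<^sub>R (of_real (- 2 * vp_defect (real k * (2 / real n))) * a k)) = (\<lambda>k. of_real (c k) * a k)"
    by (simp add: c_def scaleR_conv_of_real algebra_simps)
  finally have "(\<lambda>k. of_real (c k) * a k) sums (f z - - (1 / pi) *\<^sub>R ?I)" .
  moreover have "(\<lambda>k. of_real (c k) * a k) sums (\<Sum>k<n. of_real (c k) * a k)"
  proof (rule sums_finite)
    fix k
    assume "k \<notin> {..<n}"
    then have "2 \<le> k * (2 / real n)"
      using n by (simp add: field_simps)
    then show "of_real (c k) * a k = 0"
      by (simp add: c_def vp_defect_eq)
  qed simp
  ultimately have "f z - - (1 / pi) *\<^sub>R ?I = (\<Sum>k<n. of_real (c k) * a k)"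
    by (rule sums_unique2)
  also have "\<dots> = poly (vp_poly n f) z"
    by (simp add: vp_poly_def poly_sum poly_monom a_def c_def mult.assoc)
  finally show ?thesis
    by (simp add: algebra_simps)
qed

section \<open>Norm estimates for second differences and for the error\<close>

lemma rot_diff2_powr_integrable:
  assumes p: "0 \<le> p" and f: "f \<in> bergman_space p \<alpha>"
  shows "integrable (disc_measure \<alpha>) (\<lambda>z. norm (rot_diff2 f t z) powr p)"
proof (rule Bochner_Integration.integrable_bound)
  let ?D = "disc_measure \<alpha>"
  have f': "continuous_on (ball 0 1) f" "integrable ?D (\<lambda>z. norm (f z) powr p)"
    using f by (auto simp: bergman_space_def holomorphic_on_imp_continuous_on)
  have f_meas [measurable]: "f \<in> borel_measurable ?D"
    by (intro continuous_on_imp_measurable_disc_measure f')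
  have [measurable]: "(\<lambda>z. f (cis s * z)) \<in> borel_measurable ?D" for s
    by (rule measurable_compose[OF measurable_cis_disc_measure f_meas])
  show "(\<lambda>z. norm (rot_diff2 f t z) powr p) \<in> borel_measurable ?D"
    unfolding rot_diff2_def by measurable
  let ?b = "\<lambda>z. 2 powr p * (2 powr p * (norm (f (cis t * z)) powr p + norm (f (cis (- t) * z)) powr p)
    + 2 powr p * norm (f z) powr p)"
  show "integrable ?D ?b"
    by (intro integrable_mult_right Bochner_Integration.integrable_add f'(2)
        integrable_disc_measure_cis[of \<alpha> "\<lambda>z. norm (f z) powr p"])
  have "norm (rot_diff2 f t z) powr p \<le> ?b z" for z
  proof -
    have "norm (rot_diff2 f t z) powr p \<le>
        2 powr p * (norm (f (cis t * z) - (- f (cis (- t) * z))) powr p + norm (2 * f z) powr p)"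
      unfolding rot_diff2_def using norm_diff_powr_le[OF p, of "f (cis t * z) + f (cis (- t) * z)" "2 * f z"]
      by simp
    also have "\<dots> \<le> ?b z"
      using norm_diff_powr_le[OF p, of "f (cis t * z)" "- f (cis (- t) * z)"]
      by (intro mult_left_mono add_mono) (auto simp: norm_mult powr_mult)
    finally show ?thesis .
  qed
  then show "AE z in ?D. norm (norm (rot_diff2 f t z) powr p) \<le> norm (?b z)"
    by (intro AE_I2) (auto intro: order_trans[OF _ abs_ge_self])
qed

lemma zygmund_bound_nonneg:
  assumes "zygmund_bound \<beta> p \<alpha> f C"
  shows "0 \<le> C"
proof -
  have "bergman_norm p \<alpha> (rot_diff2 f 1) \<le> C"
    using assms[unfolded zygmund_bound_def, rule_format, of 1] by simp
  moreover have "0 \<le> bergman_norm p \<alpha> (rot_diff2 f 1)"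
    by (simp add: bergman_norm_def)
  ultimately show ?thesis
    by linarith
qed

lemma zygmund_bound_nn_integral_le:
  assumes p: "0 < p" and f: "f \<in> bergman_space p \<alpha>" and C: "zygmund_bound \<beta> p \<alpha> f C"
  shows "(\<integral>\<^sup>+z. ennreal (norm (rot_diff2 f t z) powr p) \<partial>disc_measure \<alpha>) \<le> ennreal ((C * \<bar>t\<bar> powr \<beta>) powr p)"
proof -
  let ?I = "\<integral>z. norm (rot_diff2 f t z) powr p \<partial>disc_measure \<alpha>"
  have "?I powr (1 / p) \<le> C * \<bar>t\<bar> powr \<beta>"
    using C by (simp add: zygmund_bound_def bergman_norm_def)
  then have "(?I powr (1 / p)) powr p \<le> (C * \<bar>t\<bar> powr \<beta>) powr p"
    using p by (intro powr_mono2) auto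
  then have "?I \<le> (C * \<bar>t\<bar> powr \<beta>) powr p"
    using p by (simp add: powr_powr)
  then show ?thesis
    using p f by (subst nn_integral_eq_integral) (auto intro: rot_diff2_powr_integrable ennreal_leI)
qed

text \<open>Nothing is known about f outside the disc, so the rotation has to be measurable as a map
  into \<open>disc_measure \<alpha>\<close> before f is composed with it.\<close>

lemma rot_diff2_measurable_pair:
  assumes f: "continuous_on (ball 0 1) f"
  shows "(\<lambda>(t, z). rot_diff2 f (h * t) z) \<in> borel_measurable (lborel \<Otimes>\<^sub>M disc_measure \<alpha>)"
proof -
  have snd_borel [measurable]: "snd \<in> (lborel :: real measure) \<Otimes>\<^sub>M disc_measure \<alpha> \<rightarrow>\<^sub>M (borel :: complex measure)"
    by (rule measurable_compose[OF measurable_snd continuous_on_imp_measurable_disc_measure[OF continuous_on_id]])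
  have [measurable]: "cis \<in> borel_measurable borel"
    by (intro borel_measurable_continuous_onI continuous_intros)
  have rot: "(\<lambda>x. cis (c * fst x) * snd x) \<in> lborel \<Otimes>\<^sub>M disc_measure \<alpha> \<rightarrow>\<^sub>M disc_measure \<alpha>" for c :: real
    unfolding measurable_cong_sets[OF refl sets_disc_measure]
  proof (rule measurable_restrict_space2)
    show "(\<lambda>x. cis (c * fst x) * snd x) \<in> space (lborel \<Otimes>\<^sub>M disc_measure \<alpha>) \<rightarrow> ball 0 1"
      by (auto simp: space_pair_measure norm_mult)
    show "(\<lambda>x. cis (c * fst x) * snd x) \<in> borel_measurable (lborel \<Otimes>\<^sub>M disc_measure \<alpha>)"
      by measurable
  qed
  have f_meas: "f \<in> borel_measurable (disc_measure \<alpha>)"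
    by (rule continuous_on_imp_measurable_disc_measure[OF f])
  have [measurable]: "(\<lambda>x. f (cis (h * fst x) * snd x)) \<in> borel_measurable (lborel \<Otimes>\<^sub>M disc_measure \<alpha>)"
    "(\<lambda>x. f (cis (- (h * fst x)) * snd x)) \<in> borel_measurable (lborel \<Otimes>\<^sub>M disc_measure \<alpha>)"
    "(\<lambda>x. f (snd x)) \<in> borel_measurable (lborel \<Otimes>\<^sub>M disc_measure \<alpha>)"
    using measurable_compose[OF rot[of h] f_meas] measurable_compose[OF rot[of "- h"] f_meas]
      measurable_compose[OF measurable_snd f_meas] by simp_all
  show ?thesis
    unfolding rot_diff2_def case_prod_beta by measurable
qed

text \<open>The kernel is split as m times \<open>t powr (- \<beta>)\<close> with the sign of the
  cosine difference. The power cancels the growth in the Zygmund condition, so G, the second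
  difference with this factor, has norm at most C h^\<beta> uniformly in t, while m has the Jackson
  integral as its mass. Minkowski's inequality multiplies the two.\<close>

lemma bergman_norm_diff_vp_poly_le:
  assumes p: "1 \<le> p" and \<alpha>: "- 1 < \<alpha>" and \<beta>: "0 \<le> \<beta>" "\<beta> < 1"
    and f: "f \<in> bergman_space p \<alpha>" and C: "zygmund_bound \<beta> p \<alpha> f C" and n: "1 \<le> n"
  shows "bergman_norm p \<alpha> (\<lambda>z. f z - poly (vp_poly n f) z) \<le>
    (LBINT t:{0<..}. \<bar>cos t - cos (2 * t)\<bar> * t powr (\<beta> - 2)) / pi * (2 / n) powr \<beta> * C"
proof -
  let ?D = "disc_measure \<alpha>"
  define h where "h = 2 / real n"
  have h: "0 < h"
    using n by (simp add: h_def)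
  have C0: "0 \<le> C"
    using C by (rule zygmund_bound_nonneg)
  define m where "m = (\<lambda>t. indicator {0<..} t * (\<bar>cos t - cos (2 * t)\<bar> * t powr (\<beta> - 2)))"
  define G where "G = (\<lambda>t z. (indicator {0<..} t * sgn (cos t - cos (2 * t)) * t powr (- \<beta>)) *\<^sub>R rot_diff2 f (h * t) z)"
  define L where "L = (\<integral>t. m t \<partial>lborel)"
  have f': "f holomorphic_on ball 0 1" "continuous_on (ball 0 1) f"
    using f by (auto simp: bergman_space_def holomorphic_on_imp_continuous_on)
  have m: "integrable lborel m" "\<And>t. 0 \<le> m t"
    using jackson_weight_integrable[OF \<beta>] by (auto simp: m_def set_integrable_def)
  then have L: "0 \<le> L"
    by (simp add: L_def)
  have Leq: "L = (LBINT t:{0<..}. \<bar>cos t - cos (2 * t)\<bar> * t powr (\<beta> - 2))"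
    by (simp add: L_def m_def set_lebesgue_integral_def)
  have mG: "m t *\<^sub>R G t z = (indicator {0<..} t * vp_kernel t) *\<^sub>R rot_diff2 f (h * t) z" for t z
  proof (cases "0 < t")
    case True
    then have "t powr (\<beta> - 2) * t powr (- \<beta>) = 1 / t\<^sup>2"
      by (simp add: powr_diff powr_minus powr_numeral)
    then have "m t * (indicator {0<..} t * sgn (cos t - cos (2 * t)) * t powr (- \<beta>)) = vp_kernel t"
      using True abs_mult_sgn[of "cos t - cos (2 * t)"]
      by (simp add: m_def vp_kernel_def mult_ac divide_inverse)
    then show ?thesis
      using True by (simp add: G_def)
  qed (simp add: m_def)
  have G_meas: "(\<lambda>(t, z). G t z) \<in> borel_measurable (lborel \<Otimes>\<^sub>M ?D)"
  proof -
    have [measurable]: "(\<lambda>x. rot_diff2 f (h * fst x) (snd x)) \<in> borel_measurable (lborel \<Otimes>\<^sub>M ?D)"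
      using rot_diff2_measurable_pair[OF f'(2), of h \<alpha>] by (simp add: case_prod_beta)
    show ?thesis
      unfolding G_def case_prod_beta by measurable
  qed
  have G_le: "(\<integral>\<^sup>+z. ennreal (norm (G t z) powr p) \<partial>?D) \<le> ennreal ((C * h powr \<beta>) powr p)" for t
  proof (cases "0 < t")
    case True
    let ?s = "t powr (- \<beta>)"
    have "(\<integral>\<^sup>+z. ennreal (norm (G t z) powr p) \<partial>?D) \<le>
        (\<integral>\<^sup>+z. ennreal (?s powr p) * ennreal (norm (rot_diff2 f (h * t) z) powr p) \<partial>?D)"
    proof (rule nn_integral_mono)
      fix z
      have "norm (G t z) \<le> ?s * norm (rot_diff2 f (h * t) z)"
        using True by (auto simp: G_def abs_mult sgn_if intro!: mult_right_mono)
      then have "norm (G t z) powr p \<le> (?s * norm (rot_diff2 f (h * t) z)) powr p"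
        using p by (intro powr_mono2) auto
      also have "\<dots> = ?s powr p * norm (rot_diff2 f (h * t) z) powr p"
        by (simp add: powr_mult)
      finally show "ennreal (norm (G t z) powr p) \<le>
          ennreal (?s powr p) * ennreal (norm (rot_diff2 f (h * t) z) powr p)"
        by (simp add: ennreal_mult[symmetric] ennreal_leI)
    qed
    also have "\<dots> = ennreal (?s powr p) * (\<integral>\<^sup>+z. ennreal (norm (rot_diff2 f (h * t) z) powr p) \<partial>?D)"
      using rot_diff2_powr_integrable[OF _ f, of "h * t"] p by (intro nn_integral_cmult) auto
    also have "\<dots> \<le> ennreal (?s powr p) * ennreal ((C * \<bar>h * t\<bar> powr \<beta>) powr p)"
      using p by (intro mult_left_mono zygmund_bound_nn_integral_le f C) auto
    also have "\<dots> = ennreal ((?s * (C * \<bar>h * t\<bar> powr \<beta>)) powr p)"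
      using C0 by (simp add: ennreal_mult[symmetric] powr_mult)
    also have "?s * (C * \<bar>h * t\<bar> powr \<beta>) = C * h powr \<beta>"
      using True h by (simp add: powr_mult powr_minus field_simps)
    finally show ?thesis .
  qed (use p in \<open>simp add: G_def\<close>)
  have sf: "sigma_finite_measure ?D"
    using finite_measure_disc_measure[OF \<alpha>] by (simp add: finite_measure_def)
  let ?g = "\<lambda>z. f z - poly (vp_poly n f) z"
  have "(\<integral>\<^sup>+z. ennreal (norm (?g z) powr p) \<partial>?D) =
      (\<integral>\<^sup>+z. ennreal ((1 / pi) powr p) * ennreal (norm (\<integral>t. m t *\<^sub>R G t z \<partial>lborel) powr p) \<partial>?D)"
  proof (rule nn_integral_cong)
    fix z
    assume "z \<in> space ?D"
    then have "norm (?g z) = 1 / pi * norm (\<integral>t. m t *\<^sub>R G t z \<partial>lborel)"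
      unfolding mG h_def using diff_vp_poly_eq[OF f'(1) _ n, of z] by simp
    then show "ennreal (norm (?g z) powr p) =
        ennreal ((1 / pi) powr p) * ennreal (norm (\<integral>t. m t *\<^sub>R G t z \<partial>lborel) powr p)"
      by (simp only: powr_mult ennreal_mult powr_ge_zero norm_ge_zero)
  qed
  also have "\<dots> = ennreal ((1 / pi) powr p) * (\<integral>\<^sup>+z. ennreal (norm (\<integral>t. m t *\<^sub>R G t z \<partial>lborel) powr p) \<partial>?D)"
  proof (rule nn_integral_cmult)
    have [measurable]: "(\<lambda>(z, t). G t z) \<in> borel_measurable (?D \<Otimes>\<^sub>M lborel)"
      using measurable_pair_swap[OF G_meas] by (simp add: case_prod_beta)
    have [measurable]: "m \<in> borel_measurable borel"
      using m by simp
    show "(\<lambda>z. ennreal (norm (\<integral>t. m t *\<^sub>R G t z \<partial>lborel) powr p)) \<in> borel_measurable ?D"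
      by measurable
  qed
  also have "\<dots> \<le> ennreal ((1 / pi) powr p) * (ennreal (L powr p) * ennreal ((C * h powr \<beta>) powr p))"
    unfolding L_def
    by (intro mult_left_mono weighted_Minkowski_inequality sf p m G_meas G_le) (auto intro: sigma_finite_lborel)
  also have "\<dots> = ennreal ((L / pi * h powr \<beta> * C) powr p)"
    using L C0 by (simp add: ennreal_mult[symmetric] powr_mult powr_divide mult_ac)
  finally have "(\<integral>\<^sup>+z. ennreal (norm (?g z) powr p) \<partial>?D) \<le> ennreal ((L / pi * h powr \<beta> * C) powr p)" .
  moreover have "(\<integral>\<^sup>+z. ennreal (norm (?g z) powr p) \<partial>?D) = ennreal (\<integral>z. norm (?g z) powr p \<partial>?D)"
    using p by (intro nn_integral_eq_integral bergman_space_diff_poly_integrable \<alpha> f) auto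
  ultimately have "(\<integral>z. norm (?g z) powr p \<partial>?D) \<le> (L / pi * h powr \<beta> * C) powr p"
    by simp
  then have "bergman_norm p \<alpha> ?g \<le> ((L / pi * h powr \<beta> * C) powr p) powr (1 / p)"
    unfolding bergman_norm_def using p by (intro powr_mono2) auto
  also have "\<dots> = L / pi * h powr \<beta> * C"
    using p L C0 by (simp add: powr_powr)
  finally show ?thesis
    by (simp add: Leq h_def)
qed

theorem theorem2p1:
  fixes p \<alpha> \<beta> :: real and f :: "complex \<Rightarrow> complex" and n :: nat
  assumes "1 < p" and "- 1 < \<alpha>" and "0 < \<beta>" and "\<beta> < 1"
    and "f \<in> zygmund_space \<beta> p \<alpha>"
    and "1 \<le> n"
  shows "best_approx n p \<alpha> f \<le> jackson_const \<beta> * real n powr (- \<beta>) * zygmund_norm \<beta> p \<alpha> f"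
proof -
  define A where "A = jackson_const \<beta> * real n powr (- \<beta>)"
  let ?S = "{C. zygmund_bound \<beta> p \<alpha> f C}"
  let ?L = "LBINT t:{0<..}. \<bar>cos t - cos (2 * t)\<bar> * t powr (\<beta> - 2)"
  have f: "f \<in> bergman_space p \<alpha>" and ne: "?S \<noteq> {}"
    using assms by (auto simp: zygmund_space_def)
  have L: "0 \<le> ?L"
    unfolding set_lebesgue_integral_def by (intro integral_nonneg_AE) auto
  then have A: "0 \<le> A"
    by (simp add: A_def jackson_const_def)
  have le: "best_approx n p \<alpha> f \<le> A * C" if "C \<in> ?S" for C
  proof -
    have C: "zygmund_bound \<beta> p \<alpha> f C" and C0: "0 \<le> C"
      using that zygmund_bound_nonneg by auto
    have "best_approx n p \<alpha> f \<le> bergman_norm p \<alpha> (\<lambda>z. f z - poly (vp_poly n f) z)"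
      using assms by (intro best_approx_le f degree_vp_poly_le) auto
    also have "\<dots> \<le> ?L / pi * (2 / n) powr \<beta> * C"
      using assms by (intro bergman_norm_diff_vp_poly_le f C) auto
    also have "(2 / n) powr \<beta> = 2 powr \<beta> * real n powr (- \<beta>)"
      by (simp add: powr_divide powr_minus_divide)
    \<comment> \<open>Here the spare factor 2 of the claimed constant is given away.\<close>
    also have "?L / pi * (2 powr \<beta> * real n powr (- \<beta>)) * C \<le>
        ?L / pi * (2 powr (1 + \<beta>) * real n powr (- \<beta>)) * C"
      using L C0 by (intro mult_right_mono mult_left_mono powr_mono) auto
    finally show ?thesis
      by (simp add: A_def jackson_const_def mult_ac)
  qed
  have "best_approx n p \<alpha> f \<le> A * Inf ?S"
  \<comment> \<open>Passing to the infimum divides by A. The case distinction spares a proof that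
    the Jackson integral is positive: if A = 0, any admissible C already gives the bound 0.\<close>
  proof (cases "A = 0")
    case True
    then show ?thesis
      using le ne by auto
  next
    case False
    then have "best_approx n p \<alpha> f / A \<le> Inf ?S"
      using A le by (intro cInf_greatest ne) (simp add: divide_le_eq mult.commute)
    then show ?thesis
      using A False by (simp add: divide_le_eq mult.commute)
  qed
  then show ?thesis
    by (simp add: A_def zygmund_norm_def)
qed

end
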